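(* Let $A \in \{0,\star\}^{d\times d}$ and $B\in\{0,\star\}^{d\times m}$ be such that $(A,B)$ is structurally controllable, and let each nonzero entry $B_{ij}$ carry a cost $w_{ij}$. Suppose that the digraph $G(A)$ is strongly connected and that the bipartite graph $\Gamma(A)$ does not have a perfect matching. If $w_{ij}>0$ for every nonzero entry $B_{ij}$ of $B$, then the matrix $B^{*}$ produced by the matching algorithm (described in the context) solves the problem $$\min_{B'\in\mathcal{K}} \|B'\|_w \quad\text{subject to}\quad \|B'\|_0\le \|B''\|_0 \ \text{ for all } B''\in\mathcal{K};$$ that is, $B^{*}\in\mathcal K$ has the minimum number of nonzero entries among elements of $\mathcal{K}$, and has minimum cost $\|\cdot\|_w$ among all elements of $\mathcal{K}$ with the minimum number of nonzero entries.
   Context: A matrix with entries in $\{0,\star\}$ is a sparsity matrix: each entry is either a fixed zero or an independent free parameter $\star$. A numerical realization is obtained by assigning real values to the $\star$ entries (zeros stay zero). The pair $(A,B)$ with $A\in\{0,\star\}^{d\times d}$, $B\in\{0,\star\}^{d\times m}$ is structurally controllable if there is at least one numerical realization $(A',B')$ of $(A,B)$ such that the linear system $\dot x = A'x+B'u$ is controllable. $Z(B)=\{(i,j) : B_{ij}=0\}$, and $\mathcal{K}$ is the set of all $B'\in\{0,\star\}^{d\times m}$ with $Z(B)\subset Z(B')$ and $(A,B')$ structurally controllable. $\|B'\|_0$ is the number of nonzero ($\star$) entries of $B'$, and $\|B'\|_w=\sum_{(i,j): B'_{ij}\ne0} w_{ij}$. $G(A)$ is the digraph with vertex set $\{v_1,\dots,v_d\}$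 and a directed edge $(v_j,v_i)$ whenever $A_{ij}\neq 0$; it is strongly connected if for each ordered pair of vertices there is a directed path from the first to the second. $\Gamma(A,B)$ is the undirected bipartite graph with parts $V_A^1\sqcup V_B$ and $V_A^2$, where $V_A^1=\{v_1^1,\dots,v_d^1\}$, $V_A^2=\{v_1^2,\dots,v_d^2\}$, $V_B=\{u_1,\dots,u_m\}$, and edge set $\mathcal{E}_A\sqcup\mathcal{E}_B$, where $\mathcal{E}_A=\{(v_j^1,v_i^2): A_{ij}\ne0\}$ and $\mathcal{E}_B=\{(u_j,v_i^2): B_{ij}\neq0\}$. $\Gamma(A)$ is its induced subgraph on $V_A^1\sqcup V_A^2$ (edge set $\mathcal{E}_A$). A matching is perfect if it saturates all vertices. Given a non-negative edge cost function, a minimum cost maximum matching (MCMM) is a matching of maximum cardinality whose total cost is minimal among all maximum cardinality matchings. Matching algorithm. Construct $\Gamma(A,B)$, with cost $c(e)=0$ for $e\in\mathcal{E}_A$ and $c(e)=w_{kj}$ for $e=(u_j,v_k^2)\in\mathcal{E}_B$. Find an MCMM $M^{*}$ in $\Gamma(A,B)$ with cost $c$. Output $B^{*}\in\{0,\star\}^{d\times m}$ with $B^{*}_{\ell k}=\star$ if $(u_k,v_\ell^2)\in M^{*}\cap\mathcal{E}_B$ and $B^{*}_{\ell k}=0$ otherwise. *)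

theory Defs
  imports "HOL-Analysis.Analysis" "Graph_Theory.Digraph_Component"
begin

datatype entry = Zero | Star

text \<open>A sparsity matrix with \<open>d\<close> rows and \<open>m\<close> columns has type \<open>entry^'m^'d\<close>, and
  \<open>M $ i $ j\<close> is its entry in row \<open>i\<close> and column \<open>j\<close>, as for real matrices.\<close>

definition realization :: "entry^'m^'d \<Rightarrow> real^'m^'d \<Rightarrow> bool" where
  "realization M M' \<longleftrightarrow> (\<forall>i j. M $ i $ j = Zero \<longrightarrow> M' $ i $ j = 0)"

text \<open>Controllability of \<open>x' = A x + B u\<close> by state transfer. Inputs are continuous and
  solutions classical; for linear time-invariant systems, admitting piecewise continuous or
  locally integrable inputs defines the same notion.\<close>

definition controllable :: "real^'d^'d \<Rightarrow> real^'m^'d \<Rightarrow> bool" where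
  "controllable A B \<longleftrightarrow>
     (\<forall>x0 x1. \<exists>T>0. \<exists>(u :: real \<Rightarrow> real^'m) (x :: real \<Rightarrow> real^'d).
        continuous_on {0..T} u \<and> x 0 = x0 \<and> x T = x1 \<and>
        (\<forall>t\<in>{0..T}. (x has_vector_derivative (A *v x t + B *v u t)) (at t within {0..T})))"

definition structurally_controllable :: "entry^'d^'d \<Rightarrow> entry^'m^'d \<Rightarrow> bool" where
  "structurally_controllable A B \<longleftrightarrow>
     (\<exists>A' B'. realization A A' \<and> realization B B' \<and> controllable A' B')"

definition zeros :: "entry^'m^'d \<Rightarrow> ('d \<times> 'm) set" where
  "zeros B = {(i, j). B $ i $ j = Zero}"

definition feasible :: "entry^'d^'d \<Rightarrow> entry^'m^'d \<Rightarrow> (entry^'m^'d) set" where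
  "feasible A B = {B'. zeros B \<subseteq> zeros B' \<and> structurally_controllable A B'}"

definition norm0 :: "entry^'m^'d \<Rightarrow> nat" where
  "norm0 B = card {(i, j). B $ i $ j \<noteq> Zero}"

definition norm_w :: "real^'m^'d \<Rightarrow> entry^'m^'d \<Rightarrow> real" where
  "norm_w w B = (\<Sum>(i, j) | B $ i $ j \<noteq> Zero. w $ i $ j)"

text \<open>The arc \<open>(j, i)\<close> is present when \<open>A $ i $ j\<close> is nonzero: columns are tails, rows are heads.\<close>

definition state_digraph :: "entry^'d^'d \<Rightarrow> ('d, 'd \<times> 'd) pre_digraph" where
  "state_digraph A =
     \<lparr>verts = UNIV, arcs = {(j, i). A $ i $ j \<noteq> Zero}, tail = fst, head = snd\<rparr>"

text \<open>Undirected bipartite graphs. The two parts may have different types, and an edge is the pair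
  of its left and its right end; two edges share an end iff they agree in a component.\<close>

record ('l, 'r) bigraph =
  lefts :: "'l set"
  rights :: "'r set"
  edges :: "('l \<times> 'r) set"

definition induced_bigraph ::
    "('l, 'r) bigraph \<Rightarrow> 'l set \<Rightarrow> 'r set \<Rightarrow> ('l, 'r) bigraph" where
  "induced_bigraph G L R = \<lparr>lefts = L, rights = R, edges = edges G \<inter> (L \<times> R)\<rparr>"

definition matching :: "('l, 'r) bigraph \<Rightarrow> ('l \<times> 'r) set \<Rightarrow> bool" where
  "matching G M \<longleftrightarrow> M \<subseteq> edges G \<and> inj_on fst M \<and> inj_on snd M"

definition perfect_matching :: "('l, 'r) bigraph \<Rightarrow> ('l \<times> 'r) set \<Rightarrow> bool" where
  "perfect_matching G M \<longleftrightarrow> matching G M \<and> fst ` M = lefts G \<and> snd ` M = rights G"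

text \<open>Maximality of cardinality is meant for finite graphs.\<close>

definition maximum_matching :: "('l, 'r) bigraph \<Rightarrow> ('l \<times> 'r) set \<Rightarrow> bool" where
  "maximum_matching G M \<longleftrightarrow> matching G M \<and> (\<forall>N. matching G N \<longrightarrow> card N \<le> card M)"

definition min_cost_maximum_matching ::
    "('l, 'r) bigraph \<Rightarrow> ('l \<times> 'r \<Rightarrow> real) \<Rightarrow> ('l \<times> 'r) set \<Rightarrow> bool" where
  "min_cost_maximum_matching G c M \<longleftrightarrow>
     maximum_matching G M \<and> (\<forall>N. maximum_matching G N \<longrightarrow> sum c M \<le> sum c N)"

text \<open>\<open>V1 j\<close> and \<open>U j\<close> are the left vertices of \<open>\<Gamma>(A,B)\<close> for the \<open>j\<close>-th column of \<open>A\<close> and of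
  \<open>B\<close>; the right vertices are the rows, represented by their index.\<close>

datatype ('d, 'm) left_vertex = V1 'd | U 'm

definition edges_A :: "entry^'d^'d \<Rightarrow> (('d, 'm) left_vertex \<times> 'd) set" where
  "edges_A A = {(V1 j, i) | i j. A $ i $ j \<noteq> Zero}"

definition edges_B :: "entry^'m^'d \<Rightarrow> (('d, 'm) left_vertex \<times> 'd) set" where
  "edges_B B = {(U j, i) | i j. B $ i $ j \<noteq> Zero}"

definition Gamma_AB :: "entry^'d^'d \<Rightarrow> entry^'m^'d \<Rightarrow> (('d, 'm) left_vertex, 'd) bigraph" where
  "Gamma_AB A B =
     \<lparr>lefts = range V1 \<union> range U, rights = UNIV, edges = edges_A A \<union> edges_B B\<rparr>"

text \<open>The graph \<open>\<Gamma>(A)\<close>; it depends on \<open>B\<close> only through the type of its left vertices.\<close>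

definition Gamma_A :: "entry^'d^'d \<Rightarrow> entry^'m^'d \<Rightarrow> (('d, 'm) left_vertex, 'd) bigraph" where
  "Gamma_A A B = induced_bigraph (Gamma_AB A B) (range V1) UNIV"

lemma Gamma_A_eq: "Gamma_A A B = \<lparr>lefts = range V1, rights = UNIV, edges = edges_A A\<rparr>"
  by (auto simp: Gamma_A_def induced_bigraph_def Gamma_AB_def edges_A_def edges_B_def)

fun edge_cost :: "real^'m^'d \<Rightarrow> ('d, 'm) left_vertex \<times> 'd \<Rightarrow> real" where
  "edge_cost w (V1 j, i) = 0"
| "edge_cost w (U j, i) = w $ i $ j"

definition matrix_of_matching :: 
    "entry^'m^'d \<Rightarrow> (('d, 'm) left_vertex \<times> 'd) set \<Rightarrow> entry^'m^'d" where
  "matrix_of_matching B M = (\<chi> l k. if (U k, l) \<in> M \<inter> edges_B B then Star else Zero)"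

text \<open>The minimum cost maximum matching need not be unique, so the algorithm is a relation between
  its input and its possible outputs.\<close>

definition matching_algorithm_output ::
    "entry^'d^'d \<Rightarrow> entry^'m^'d \<Rightarrow> real^'m^'d \<Rightarrow> entry^'m^'d \<Rightarrow> bool" where
  "matching_algorithm_output A B w Bs \<longleftrightarrow>
     (\<exists>M. min_cost_maximum_matching (Gamma_AB A B) (edge_cost w) M \<and>
          Bs = matrix_of_matching B M)"

end

theory Submission
  imports Defs "HOL-Computational_Algebra.Fundamental_Theorem_Algebra"
begin

text \<open>
  Controllability of a realization of \<open>(A,B')\<close> forces the rows of \<open>[A B']\<close> to be independent, hence a
  matching of \<open>\<Gamma>(A,B')\<close> that saturates all rows. Conversely, such a matching with at least one input
  edge splits the states into paths starting at inputs and cycles; giving the cycles weights of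
  increasing modulus and joining each of them by one edge to what is already there (strong
  connectivity) yields a realization that passes the eigenvector test for controllability. So the
  feasible matrices are exactly the sparser \<open>B'\<close> whose support contains the input edges of a
  row-saturating matching. Every such matching uses an input edge because \<open>\<Gamma>(A)\<close> has no perfect
  matching. It remains to see that a minimum cost maximum matching also has the fewest input edges:
  otherwise an augmenting path in \<open>\<Gamma>(A)\<close> would cover one more row with edges of \<open>A\<close> and make an
  input edge of positive cost superfluous.
\<close>

section \<open>Matchings in \<open>\<Gamma>(A,B)\<close>\<close>

text \<open>Augmenting paths by recursion: take an edge \<open>(l, r)\<close> of \<open>N\<close>
  whose row \<open>r\<close> is not covered by \<open>X\<close>. If \<open>l\<close> is already used
  in \<open>X\<close>, delete the left vertex \<open>l\<close> from both matchings, augment what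
  remains, and put \<open>l\<close> back.\<close>

lemma matching_augment:
  assumes "finite X" "inj_on fst X" "inj_on snd X"
    and "finite N" "inj_on fst N" "inj_on snd N" and "card X < card N"
  shows "\<exists>X' r. X' \<subseteq> X \<union> N \<and> inj_on fst X' \<and> inj_on snd X' \<and>
    r \<notin> snd ` X \<and> snd ` X' = insert r (snd ` X)"
  using assms
proof (induction "card X" arbitrary: X N)
  case (0 X N)
  then have "X = {}" "N \<noteq> {}"
    by auto
  then obtain e where "e \<in> N"
    by blast
  then show ?case
    using \<open>X = {}\<close> by (intro exI[of _ "{e}"] exI[of _ "snd e"]) auto
next
  case (Suc n X N)
  have "card (snd ` X) < card (snd ` N)"
    using Suc.prems by (simp add: card_image)
  then have "\<not> snd ` N \<subseteq> snd ` X"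
    using Suc.prems(1) card_mono by (metis finite_imageI leD)
  then obtain r where "r \<in> snd ` N" and r: "r \<notin> snd ` X"
    by blast
  then obtain l where lr: "(l, r) \<in> N"
    by auto
  show ?case
  proof (cases "l \<in> fst ` X")
    case False
    then have "inj_on fst (insert (l, r) X)" "inj_on snd (insert (l, r) X)"
      using Suc.prems r by (auto simp: inj_on_insert)
    then show ?thesis
      using lr r by (intro exI[of _ "insert (l, r) X"] exI[of _ r]) auto
  next
    case True
    then obtain r' where lr': "(l, r') \<in> X"
      by auto
    define X0 N0 where "X0 = X - {(l, r')}" and "N0 = N - {(l, r)}"
    have l0: "l \<notin> fst ` (X0 \<union> N0)"
      using inj_onD[OF Suc.prems(2) _ _ lr'] inj_onD[OF Suc.prems(5) _ _ lr]
      by (auto simp: X0_def N0_def)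
    have sX0: "snd ` X0 = snd ` X - {r'}"
      using inj_on_image_set_diff[OF Suc.prems(3), of X "{(l, r')}"] lr' by (simp add: X0_def)
    have "n = card X0" "card X0 < card N0"
      using Suc.hyps(2) Suc.prems lr lr' by (auto simp: X0_def N0_def)
    moreover have "finite X0" "inj_on fst X0" "inj_on snd X0"
        "finite N0" "inj_on fst N0" "inj_on snd N0"
      using Suc.prems by (simp_all add: X0_def N0_def inj_on_diff)
    ultimately obtain Y r2 where
      Y: "Y \<subseteq> X0 \<union> N0" "inj_on fst Y" "inj_on snd Y"
      and r2: "r2 \<notin> snd ` X0" "snd ` Y = insert r2 (snd ` X0)"
      using Suc.hyps(1) by blast
    have lY: "l \<notin> fst ` Y"
      using l0 Y(1) by auto
    \<comment> \<open>The deletion frees \<open>r'\<close>, and the recursion covers one new row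
      \<open>r2\<close>. So \<open>l\<close> returns to \<open>r'\<close>, unless
      \<open>r2 = r'\<close>; then exactly the rows of \<open>X\<close> are covered and
      \<open>r\<close> is available.\<close>
    define q where "q = (if r2 = r' then r else r')"
    have "r' \<in> snd ` X"
      using lr' by force
    have q: "q \<notin> snd ` Y"
    proof (cases "r2 = r'")
      case True
      then show ?thesis
        using r unfolding r2(2) sX0 q_def by (metis Diff_iff insertE r \<open>r' \<in> snd ` X\<close>)
    next
      case False
      then show ?thesis
        unfolding r2(2) sX0 q_def by simp
    qed
    have "inj_on fst (insert (l, q) Y)" "inj_on snd (insert (l, q) Y)"
      using Y lY q by (auto simp: inj_on_insert)
    moreover have "insert (l, q) Y \<subseteq> X \<union> N"
      using Y(1) lr lr' by (auto simp: X0_def N0_def q_def)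
    moreover have "\<exists>t. t \<notin> snd ` X \<and> snd ` insert (l, q) Y = insert t (snd ` X)"
    proof -
      have eq: "snd ` insert (l, q) Y = insert q (insert r2 (snd ` X - {r'}))"
        by (simp add: r2(2) sX0)
      have R: "insert r' (snd ` X - {r'}) = snd ` X"
        using \<open>r' \<in> snd ` X\<close> by (rule insert_Diff)
      show ?thesis
      proof (cases "r2 = r'")
        case True
        then have "insert q (insert r2 (snd ` X - {r'})) = insert r (snd ` X)"
          by (simp add: q_def R del: insert_Diff_single)
        with r show ?thesis
          unfolding eq by blast
      next
        case False
        then have "r2 \<notin> snd ` X"
          using r2(1) unfolding sX0 by simp
        moreover have "insert q (insert r2 (snd ` X - {r'})) = insert r2 (snd ` X)"
          using False by (simp add: q_def insert_commute[of r' r2] R del: insert_Diff_single)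
        ultimately show ?thesis
          unfolding eq by blast
      qed
    qed
    ultimately show ?thesis
      by blast
  qed
qed

section \<open>Edges, costs and saturation in \<open>Gamma_AB\<close>\<close>

lemma finite_edges [simp]: "finite (edges (Gamma_AB A B))"
proof -
  have "edges (Gamma_AB A B) \<subseteq> (range V1 \<union> range U) \<times> UNIV"
    by (auto simp: Gamma_AB_def edges_A_def edges_B_def)
  then show ?thesis
    by (rule finite_subset) simp
qed

lemma edges_Gamma_AB: "edges (Gamma_AB A B) = edges_A A \<union> edges_B B"
  by (simp add: Gamma_AB_def)

lemma edges_AB_disjoint: "edges_A A \<inter> edges_B B = {}"
  by (auto simp: edges_A_def edges_B_def)

lemma edge_cost_A: "e \<in> edges_A A \<Longrightarrow> edge_cost w e = 0"
  by (auto simp: edges_A_def)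

lemma edges_B_mono: "zeros B \<subseteq> zeros B' \<Longrightarrow> edges_B B' \<subseteq> edges_B B"
  by (auto simp: edges_B_def zeros_def)

lemma matching_Gamma_AB_mono:
  "matching (Gamma_AB A B') N \<Longrightarrow> zeros B \<subseteq> zeros B' \<Longrightarrow> matching (Gamma_AB A B) N"
  using edges_B_mono[of B B'] by (auto simp: matching_def edges_Gamma_AB)

lemma card_matching:
  fixes A :: "entry^'d^'d"
  assumes "matching (Gamma_AB A B) N"
  shows "card N \<le> CARD('d)" "card N = CARD('d) \<longleftrightarrow> snd ` N = UNIV"
proof -
  have "card N = card (snd ` N)"
    using assms by (simp add: matching_def card_image)
  then show "card N \<le> CARD('d)" "card N = CARD('d) \<longleftrightarrow> snd ` N = UNIV"
    by (metis card_mono finite subset_UNIV, metis card_subset_eq finite subset_UNIV)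
qed

text \<open>No matching has more edges than there are rows, so a single saturating matching fixes
  the maximum at the number of rows.\<close>

lemma maximum_matching_iff_saturating:
  assumes "matching (Gamma_AB A B) N" "snd ` N = UNIV"
  shows "maximum_matching (Gamma_AB A B) M \<longleftrightarrow> matching (Gamma_AB A B) M \<and> snd ` M = UNIV"
  using card_matching[of A B] assms unfolding maximum_matching_def by (metis le_antisym)

lemma edges_B_eq_image: "edges_B B = (\<lambda>(i, j). (U j, i)) ` {(i, j). B $ i $ j \<noteq> Zero}"
  by (auto simp: edges_B_def)

lemma card_edges_B: "card (edges_B B) = norm0 B"
  unfolding edges_B_eq_image norm0_def by (rule card_image) (auto simp: inj_on_def)

lemma sum_edges_B: "sum (edge_cost w) (edges_B B) = norm_w w B"
  unfolding edges_B_eq_image norm_w_def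
  by (subst sum.reindex) (auto simp: inj_on_def intro!: sum.cong)

lemma edges_B_matrix_of_matching: "edges_B (matrix_of_matching B M) = M \<inter> edges_B B"
  by (auto simp: edges_B_def matrix_of_matching_def split: if_splits)

lemma sum_edge_cost_matching:
  assumes "matching (Gamma_AB A B) M"
  shows "sum (edge_cost w) M = sum (edge_cost w) (M \<inter> edges_B B)"
proof (rule sum.mono_neutral_right)
  show "finite M"
    using assms finite_edges finite_subset unfolding matching_def by blast
  show "\<forall>e\<in>M - M \<inter> edges_B B. edge_cost w e = 0"
    using assms by (auto simp: matching_def edges_Gamma_AB edge_cost_A)
qed auto

text \<open>If some matching had more edges of \<open>A\<close>, augmenting the \<open>A\<close>-part of \<open>M\<close> would make one
  positive-cost edge of \<open>B\<close> superfluous.\<close>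

lemma min_cost_maximum_matching_card_A:
  fixes A :: "entry^'d^'d" and B :: "entry^'m^'d"
  assumes pos: "\<And>i j. B $ i $ j \<noteq> Zero \<Longrightarrow> w $ i $ j > 0"
    and M: "min_cost_maximum_matching (Gamma_AB A B) (edge_cost w) M" "snd ` M = UNIV"
    and N: "matching (Gamma_AB A B) N"
  shows "card (N \<inter> edges_A A) \<le> card (M \<inter> edges_A A)"
proof (rule ccontr)
  assume less: "\<not> ?thesis"
  have mM: "matching (Gamma_AB A B) M"
    using M(1) by (simp add: min_cost_maximum_matching_def maximum_matching_def)
  have fin: "finite M" "finite N"
    using mM N finite_edges finite_subset unfolding matching_def by blast+
  have "\<exists>X' r. X' \<subseteq> (M \<inter> edges_A A) \<union> (N \<inter> edges_A A) \<and> inj_on fst X' \<and> inj_on snd X' \<and>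
    r \<notin> snd ` (M \<inter> edges_A A) \<and> snd ` X' = insert r (snd ` (M \<inter> edges_A A))"
    using mM N less fin unfolding matching_def
    by (intro matching_augment) (simp_all add: inj_on_Int)
  then obtain r and X :: "(('d, 'm) left_vertex \<times> 'd) set" where X: "X \<subseteq> edges_A A" "inj_on fst X" "inj_on snd X"
      "r \<notin> snd ` (M \<inter> edges_A A)" "snd ` X = insert r (snd ` (M \<inter> edges_A A))"
    by blast
  \<comment> \<open>\<open>M\<close> covers \<open>r\<close> by an input edge. Since
    \<open>X\<close> covers \<open>r\<close> by an edge of \<open>A\<close>, that input edge is
    dropped, and \<open>X \<union> Y\<close> still saturates all rows.\<close>
  define Y where "Y = {e \<in> M \<inter> edges_B B. snd e \<noteq> r}"
  have YM: "Y \<subseteq> M"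
    by (auto simp: Y_def)
  have injM: "inj_on fst M" "inj_on snd M" and M_sub: "M \<subseteq> edges_A A \<union> edges_B B"
    using mM by (auto simp: matching_def edges_Gamma_AB)
  obtain l where l: "(l, r) \<in> M"
    using M(2) by (metis UNIV_I imageE prod.collapse)
  then have lB: "(l, r) \<in> edges_B B"
    using X(4) M_sub by force
  have only_l: "snd e = r \<longleftrightarrow> e = (l, r)" if "e \<in> M" for e
    using inj_onD[OF injM(2), of e "(l, r)"] that l by auto
  have disjY: "snd ` X \<inter> snd ` Y = {}"
  proof -
    have "snd e \<noteq> snd e'" if "e \<in> M \<inter> edges_A A" "e' \<in> Y" for e e'
      using that injM(2) edges_AB_disjoint[of A B] unfolding Y_def inj_on_def by blast
    then show ?thesis
      unfolding X(5) by (auto simp: Y_def)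
  qed
  have "fst ` X \<inter> fst ` Y = {}"
    using X(1) by (auto simp: Y_def edges_A_def edges_B_def)
  then have inj: "inj_on fst (X \<union> Y)" "inj_on snd (X \<union> Y)"
    using X(2,3) disjY injM YM by (auto simp: inj_on_Un intro: inj_on_subset)
  have mXY: "matching (Gamma_AB A B) (X \<union> Y)"
    using inj X(1) by (auto simp: matching_def edges_Gamma_AB Y_def)
  have "snd ` (X \<union> Y) = UNIV"
  proof -
    have "i \<in> snd ` (X \<union> Y)" for i
    proof -
      obtain k where k: "(k, i) \<in> M"
        using M(2) by (metis UNIV_I imageE prod.collapse)
      have "i \<in> snd ` X" if "i = r"
        using that X(5) by simp
      moreover have "i \<in> snd ` X" if "(k, i) \<in> edges_A A"
        unfolding X(5) using that k by force
      moreover have "i \<in> snd ` Y" if "i \<noteq> r" "(k, i) \<in> edges_B B"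
        using that k by (force simp: Y_def)
      ultimately show ?thesis
        using M_sub k by auto
    qed
    then show ?thesis
      by blast
  qed
  then have "maximum_matching (Gamma_AB A B) (X \<union> Y)"
    using mXY maximum_matching_iff_saturating by blast
  then have "sum (edge_cost w) M \<le> sum (edge_cost w) (X \<union> Y)"
    using M(1) by (auto simp: min_cost_maximum_matching_def)
  also have "\<dots> = sum (edge_cost w) ((X \<union> Y) \<inter> edges_B B)"
    by (rule sum_edge_cost_matching[OF mXY])
  also have "(X \<union> Y) \<inter> edges_B B = M \<inter> edges_B B - {(l, r)}"
    using X(1) edges_AB_disjoint[of A B] only_l by (auto simp: Y_def)
  also have "sum (edge_cost w) \<dots> = sum (edge_cost w) (M \<inter> edges_B B) - edge_cost w (l, r)"
    using fin l lB by (simp add: sum_diff1)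
  finally have "edge_cost w (l, r) \<le> 0"
    using sum_edge_cost_matching[OF mM, of w] by simp
  then show False
    using lB pos by (force simp: edges_B_def)
qed

section \<open>From controllability to matchings\<close>

text \<open>Along every trajectory \<open>y \<bullet> x t\<close> is constant, so steering
  \<open>0\<close> to \<open>y\<close> gives \<open>y \<bullet> y = 0\<close>.\<close>

lemma controllable_left_kernel:
  fixes A :: "real^'d^'d" and B :: "real^'m^'d" and y :: "real^'d"
  assumes "controllable A B" "y v* A = 0" "y v* B = 0"
  shows "y = 0"
proof -
  obtain T u x where T: "T > 0" and x: "x 0 = 0" "x T = y" and
    dx: "\<And>t. t \<in> {0..T} \<Longrightarrow>
      (x has_vector_derivative (A *v x t + B *v u t)) (at t within {0..T})"
    using assms(1) unfolding controllable_def by metis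
  have yAB: "y \<bullet> (A *v z) = 0" "y \<bullet> (B *v z') = 0" for z z'
    using assms(2,3) by (simp_all flip: dot_lmul_matrix)
  have "((\<lambda>t. y \<bullet> x t) has_vector_derivative 0) (at t within {0..T})" if "t \<in> {0..T}" for t
    using bounded_linear.has_vector_derivative[OF bounded_linear_inner_right dx[OF that], of y]
    by (simp add: inner_add_right yAB)
  then obtain c where "\<And>t. t \<in> {0..T} \<Longrightarrow> y \<bullet> x t = c"
    using has_vector_derivative_zero_constant[of "{0..T}" "\<lambda>t. y \<bullet> x t"] by auto
  then have "y \<bullet> x T = y \<bullet> x 0"
    using T by simp
  then show ?thesis
    by (simp add: x)
qed

text \<open>A nonzero maximal minor of \<open>[A B]\<close> has a nonzero term in its Leibniz expansion, and that
  term is a matching.\<close>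

lemma structurally_controllable_imp_saturating:
  fixes A :: "entry^'d^'d" and B :: "entry^'m^'d"
  assumes "structurally_controllable A B"
  obtains M where "matching (Gamma_AB A B) M" "snd ` M = UNIV"
proof -
  obtain A' B' where r: "realization A A'" "realization B B'" and c: "controllable A' B'"
    using assms unfolding structurally_controllable_def by blast
  \<comment> \<open>The columns of the realized \<open>[A B]\<close>, indexed by the left vertices
    of \<open>Gamma_AB\<close>.\<close>
  define col :: "('d, 'm) left_vertex \<Rightarrow> real^'d" where
    "col l = (case l of V1 j \<Rightarrow> column j A' | U k \<Rightarrow> column k B')" for l
  have "span (range col) = UNIV"
  proof (rule ccontr)
    assume "span (range col) \<noteq> UNIV"
    then obtain y where y: "y \<noteq> 0" "span (range col) \<subseteq> {z. y \<bullet> z = 0}"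
      using span_not_univ_subset_hyperplane by blast
    then have y0: "y \<bullet> col l = 0" for l
      using span_base[of "col l" "range col"] by blast
    have "y \<bullet> column j A' = 0" "y \<bullet> column k B' = 0" for j k
      using y0[of "V1 j"] y0[of "U k"] by (auto simp: col_def)
    then have "y v* A' = 0" "y v* B' = 0"
      by (simp_all add: vec_eq_iff vector_matrix_mult_def inner_vec_def column_def mult.commute)
    then show False
      using controllable_left_kernel[OF c] y(1) by blast
  qed
  moreover obtain I where I: "I \<subseteq> range col" "independent I" "range col \<subseteq> span I"
    using maximal_independent_subset by blast
  ultimately have span_I: "span I = UNIV"
    by (metis span_minimal subspace_span top.extremum_uniqueI)
  then have "card I = CARD('d)"
    using dim_span_eq_card_independent[OF I(2)] by simp
  moreover have "finite I"
    using I(2) independent_imp_finite by blast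
  ultimately obtain f :: "'d \<Rightarrow> real^'d" where f: "bij_betw f UNIV I"
    using bij_betw_iff_card[of "UNIV :: 'd set" I] by auto
  define X :: "real^'d^'d" where "X = transpose (\<chi> i. f i)"
  have "columns X = I"
    using f by (auto simp: columns_def X_def column_def transpose_def bij_betw_def)
  then have "vec.span (columns X) = UNIV"
    unfolding span_vec_eq using span_I by (rule ssubst)
  then have "invertible X"
    unfolding invertible_right_inverse matrix_right_invertible_span_columns .
  then have "det X \<noteq> 0"
    by (simp add: invertible_det_nz)
  then obtain p where p: "p permutes UNIV" and nz: "(\<Prod>i\<in>UNIV. X $ i $ p i) \<noteq> 0"
    unfolding det_def by (metis (mono_tags, lifting) mem_Collect_eq mult_zero_right sum.neutral)
  \<comment> \<open>\<open>L\<close> recovers the vertex to which each chosen column belongs. The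
    factor of the Leibniz term in row \<open>i\<close> is then an entry of the column of
    \<open>L (p i)\<close>, hence an edge.\<close>
  have "\<forall>j. \<exists>l. f j = col l"
    using f I(1) by (auto simp: bij_betw_def)
  then obtain L where L: "\<And>j. f j = col (L j)"
    by metis
  have "inj L"
    using f L by (metis bij_betw_def inj_def)
  then have inj: "inj (\<lambda>i. L (p i))"
    using permutes_inj[OF p] by (simp add: inj_def)
  define M where "M = range (\<lambda>i. (L (p i), i))"
  have nz': "col (L (p i)) $ i \<noteq> 0" for i
    using nz by (simp add: X_def transpose_def L)
  have "(L (p i), i) \<in> edges_A A \<union> edges_B B" for i
    using nz'[of i] r
    by (cases "L (p i)") (auto simp: col_def column_def edges_A_def edges_B_def realization_def)
  then have "matching (Gamma_AB A B) M"
    using inj by (auto simp: M_def matching_def Gamma_AB_def inj_on_def)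
  moreover have "snd ` M = UNIV"
    by (force simp: M_def)
  ultimately show thesis
    using that by blast
qed

section \<open>The eigenvector test for controllability\<close>

text \<open>With the horizon fixed at 1, trajectories can be added pointwise, and the attainable
  pairs of end states form a subspace.\<close>

definition trajectory_pair :: "real^'d^'d \<Rightarrow> real^'m^'d \<Rightarrow> real^'d \<Rightarrow> real^'d \<Rightarrow> bool" where
  "trajectory_pair A B x0 x1 \<longleftrightarrow> (\<exists>(u :: real \<Rightarrow> real^'m) (x :: real \<Rightarrow> real^'d).
     continuous_on {0..1} u \<and> x 0 = x0 \<and> x 1 = x1 \<and>
     (\<forall>t\<in>{0..1}. (x has_vector_derivative (A *v x t + B *v u t)) (at t within {0..1})))"

lemma trajectory_pair_imp_controllable:
  "(\<And>x0 x1. trajectory_pair A B x0 x1) \<Longrightarrow> controllable A B"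
  unfolding controllable_def trajectory_pair_def by (metis zero_less_one)

lemma trajectory_pair_add:
  assumes "trajectory_pair A B x0 x1" "trajectory_pair A B y0 y1"
  shows "trajectory_pair A B (x0 + y0) (x1 + y1)"
proof -
  obtain u x where x: "continuous_on {0..1} u" "x 0 = x0" "x 1 = x1"
    "\<And>t. t \<in> {0..1} \<Longrightarrow> (x has_vector_derivative (A *v x t + B *v u t)) (at t within {0..1})"
    using assms(1) unfolding trajectory_pair_def by metis
  obtain v y where y: "continuous_on {0..1} v" "y 0 = y0" "y 1 = y1"
    "\<And>t. t \<in> {0..1} \<Longrightarrow> (y has_vector_derivative (A *v y t + B *v v t)) (at t within {0..1})"
    using assms(2) unfolding trajectory_pair_def by metis
  have "((\<lambda>t. x t + y t) has_vector_derivative (A *v (x t + y t) + B *v (u t + v t)))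
      (at t within {0..1})" if "t \<in> {0..1}" for t
    using has_vector_derivative_add[OF x(4)[OF that] y(4)[OF that]]
    by (simp add: matrix_vector_right_distrib algebra_simps)
  moreover have "continuous_on {0..1} (\<lambda>t. u t + v t)"
    using x(1) y(1) by (intro continuous_intros)
  ultimately show ?thesis
    unfolding trajectory_pair_def using x(2,3) y(2,3)
    by (intro exI[of _ "\<lambda>t. u t + v t"] exI[of _ "\<lambda>t. x t + y t"]) auto
qed

lemma trajectory_pair_scale:
  assumes "trajectory_pair A B x0 x1"
  shows "trajectory_pair A B (c *\<^sub>R x0) (c *\<^sub>R x1)"
proof -
  obtain u x where x: "continuous_on {0..1} u" "x 0 = x0" "x 1 = x1"
    "\<And>t. t \<in> {0..1} \<Longrightarrow> (x has_vector_derivative (A *v x t + B *v u t)) (at t within {0..1})"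
    using assms(1) unfolding trajectory_pair_def by metis
  have "((\<lambda>t. c *\<^sub>R x t) has_vector_derivative (A *v (c *\<^sub>R x t) + B *v (c *\<^sub>R u t)))
      (at t within {0..1})" if "t \<in> {0..1}" for t
    using has_vector_derivative_scaleR[OF DERIV_const x(4)[OF that], of c]
    by (simp add: matrix_vector_mult_scaleR algebra_simps)
  moreover have "continuous_on {0..1} (\<lambda>t. c *\<^sub>R u t)"
    using x(1) by (intro continuous_intros)
  ultimately show ?thesis
    unfolding trajectory_pair_def using x(2,3)
    by (intro exI[of _ "\<lambda>t. c *\<^sub>R u t"] exI[of _ "\<lambda>t. c *\<^sub>R x t"]) auto
qed

lemma trajectory_pair_zero: "trajectory_pair A B 0 0"
  unfolding trajectory_pair_def
  by (intro exI[of _ "\<lambda>_. 0"] exI[of _ "\<lambda>_. 0"]) auto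

lemma subspace_trajectory_pair: "subspace {z. trajectory_pair A B (fst z) (snd z)}"
  using trajectory_pair_add[of A B] trajectory_pair_scale[of A B] trajectory_pair_zero[of A B]
  by (auto simp: subspace_def)

section \<open>Trajectories generated by a scalar polynomial\<close>

definition krylov :: "real^'d^'d \<Rightarrow> real^'d \<Rightarrow> nat \<Rightarrow> real^'d" where
  "krylov A b k = ((\<lambda>z. A *v z) ^^ k) b"

lemma krylov_0 [simp]: "krylov A b 0 = b"
  by (simp add: krylov_def)

lemma krylov_Suc: "krylov A b (Suc k) = A *v krylov A b k"
  by (simp add: krylov_def)

text \<open>If \<open>p\<close> annihilates \<open>b\<close>, these are the coefficients \<open>N\<^sub>k\<close> of the polynomial
  \<open>(p(s) - p(A)) / (s - A) * b\<close> in \<open>s\<close>. Differentiation in place of \<open>s\<close> turns every smooth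
  scalar function \<open>y\<close> into the trajectory with state \<open>\<Sum>k. y\<^sub>k N\<^sub>k\<close> and input \<open>\<Sum>k. p\<^sub>k y\<^sub>k\<close>, where
  \<open>y\<^sub>k\<close> is the derivative of order \<open>k\<close>; no matrix exponential is needed.\<close>

definition flat_coeff :: "real^'d^'d \<Rightarrow> real^'d \<Rightarrow> (nat \<Rightarrow> real) \<Rightarrow> nat \<Rightarrow> nat \<Rightarrow> real^'d" where
  "flat_coeff A b p n k = (\<Sum>j<n - k. p (k + j + 1) *\<^sub>R krylov A b j)"

lemma matrix_vector_mult_sum_scaleR:
  fixes A :: "real^'n^'m"
  shows "A *v (\<Sum>i\<in>I. c i *\<^sub>R v i) = (\<Sum>i\<in>I. c i *\<^sub>R (A *v v i))"
  by (simp add: linear_sum[OF matrix_vector_mul_linear] linear_cmul[OF matrix_vector_mul_linear] o_def)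

text \<open>Horner recursion: apart from its term \<open>j = 0\<close>, the sum
  \<open>flat_coeff A b p n k\<close> is \<open>A\<close> applied to the next coefficient.\<close>

lemma mult_flat_coeff_Suc:
  assumes "k < n"
  shows "A *v flat_coeff A b p n (Suc k) = flat_coeff A b p n k - p (Suc k) *\<^sub>R b"
proof -
  have "n - k = Suc (n - Suc k)"
    using assms by simp
  then have "flat_coeff A b p n k =
      p (Suc k) *\<^sub>R b + (\<Sum>j<n - Suc k. p (Suc k + j + 1) *\<^sub>R krylov A b (Suc j))"
    unfolding flat_coeff_def by (simp add: sum.lessThan_Suc_shift del: sum.lessThan_Suc)
  then show ?thesis
    unfolding flat_coeff_def matrix_vector_mult_sum_scaleR krylov_Suc by simp
qed

text \<open>The lower end of the recursion: \<open>A\<close> applied to the lowest coefficient gives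
  all terms of the assumed relation except the one at \<open>k = 0\<close>.\<close>

lemma mult_flat_coeff_0:
  assumes "(\<Sum>k\<le>n. p k *\<^sub>R krylov A b k) = 0"
  shows "A *v flat_coeff A b p n 0 = - (p 0 *\<^sub>R b)"
proof -
  have "A *v flat_coeff A b p n 0 = (\<Sum>j<n. p (Suc j) *\<^sub>R krylov A b (Suc j))"
    unfolding flat_coeff_def matrix_vector_mult_sum_scaleR krylov_Suc by simp
  moreover have "(\<Sum>k\<le>n. p k *\<^sub>R krylov A b k) =
      p 0 *\<^sub>R b + (\<Sum>j<n. p (Suc j) *\<^sub>R krylov A b (Suc j))"
    unfolding lessThan_Suc_atMost[symmetric] by (simp add: sum.lessThan_Suc_shift del: sum.lessThan_Suc)
  ultimately show ?thesis
    using assms by (simp add: eq_neg_iff_add_eq_0 add.commute)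
qed

text \<open>In \<open>A *v x t + B *v u t\<close> the multiples of \<open>b\<close> produced by the
  recursion cancel against the input, which leaves the sum of
  \<open>D (Suc k) t *\<^sub>R N k\<close>, the derivative of \<open>x\<close>.\<close>

lemma flat_coeff_trajectory:
  fixes A :: "real^'d^'d" and B :: "real^'m^'d" and y :: "real poly"
    and p :: "nat \<Rightarrow> real" and n :: nat and l :: 'm
  defines "N \<equiv> flat_coeff A (column l B) p n"
  assumes p: "(\<Sum>k\<le>n. p k *\<^sub>R krylov A (column l B) k) = 0"
  shows "trajectory_pair A B (\<Sum>k<n. poly ((pderiv ^^ k) y) 0 *\<^sub>R N k)
    (\<Sum>k<n. poly ((pderiv ^^ k) y) 1 *\<^sub>R N k)"
proof -
  define b where "b = column l B"
  define D where "D k = poly ((pderiv ^^ k) y)" for k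
  define x where "x t = (\<Sum>k<n. D k t *\<^sub>R N k)" for t
  define u where "u t = (\<Sum>k\<le>n. p k * D k t) *\<^sub>R (axis l 1 :: real^'m)" for t
  have Bu: "B *v u t = (\<Sum>k\<le>n. p k * D k t) *\<^sub>R b" for t
    by (simp add: u_def b_def matrix_vector_mult_scaleR matrix_vector_mult_basis)
  have dD: "(D k has_field_derivative D (Suc k) t) (at t within {0..1})" for k t
    unfolding D_def by (auto intro: has_field_derivative_at_within poly_DERIV)
  have "A *v x t + B *v u t = (\<Sum>k<n. D (Suc k) t *\<^sub>R N k)" for t
  proof (cases n)
    \<comment> \<open>The relation reads \<open>p 0 *\<^sub>R b = 0\<close>, so the input has no
      effect and the state stays \<open>0\<close>.\<close>
    case 0
    then show ?thesis
      using p by (auto simp: x_def Bu b_def)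
  next
    case (Suc m)
    \<comment> \<open>The input term of order \<open>n\<close> thus supplies the top summand
      \<open>D n t *\<^sub>R N m\<close>, which is absent from \<open>A *v x t\<close>.\<close>
    have Nn: "N m = p n *\<^sub>R b"
      by (simp add: N_def flat_coeff_def Suc b_def)
    have "A *v x t = (\<Sum>k<n. D k t *\<^sub>R (A *v N k))"
      unfolding x_def by (rule matrix_vector_mult_sum_scaleR)
    also have "\<dots> = D 0 t *\<^sub>R (A *v N 0) + (\<Sum>k<m. D (Suc k) t *\<^sub>R (A *v N (Suc k)))"
      by (simp add: Suc sum.lessThan_Suc_shift del: sum.lessThan_Suc)
    also have "A *v N 0 = - (p 0 *\<^sub>R b)"
      unfolding N_def b_def by (rule mult_flat_coeff_0[OF p])
    also have "(\<Sum>k<m. D (Suc k) t *\<^sub>R (A *v N (Suc k))) =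
        (\<Sum>k<m. D (Suc k) t *\<^sub>R (N k - p (Suc k) *\<^sub>R b))"
      by (intro sum.cong refl) (simp add: N_def b_def mult_flat_coeff_Suc Suc)
    also have "\<dots> = (\<Sum>k<m. D (Suc k) t *\<^sub>R N k) - (\<Sum>k<m. p (Suc k) * D (Suc k) t) *\<^sub>R b"
      by (simp add: scaleR_diff_right sum_subtractf scaleR_sum_left mult.commute)
    finally have Ax: "A *v x t = - (p 0 * D 0 t) *\<^sub>R b + (\<Sum>k<m. D (Suc k) t *\<^sub>R N k)
        - (\<Sum>k<m. p (Suc k) * D (Suc k) t) *\<^sub>R b"
      by (simp add: mult.commute)
    have "(\<Sum>k\<le>n. p k * D k t) = p 0 * D 0 t + (\<Sum>k<m. p (Suc k) * D (Suc k) t) + p n * D n t"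
      unfolding Suc lessThan_Suc_atMost[symmetric] sum.lessThan_Suc[of _ "Suc m"]
      by (subst sum.lessThan_Suc_shift) simp
    then have "B *v u t = (p 0 * D 0 t) *\<^sub>R b + (\<Sum>k<m. p (Suc k) * D (Suc k) t) *\<^sub>R b + D n t *\<^sub>R N m"
      by (simp add: Bu Nn scaleR_left_distrib mult.commute)
    with Ax show ?thesis
      by (simp add: Suc)
  qed
  moreover have "(x has_vector_derivative (\<Sum>k<n. D (Suc k) t *\<^sub>R N k)) (at t within {0..1})" for t
    unfolding x_def by (rule has_vector_derivative_sum)
      (rule has_vector_derivative_scaleR[OF dD has_vector_derivative_const, simplified])
  moreover have "continuous_on {0..1} u"
    unfolding u_def D_def by (intro continuous_intros)
  ultimately show ?thesis
    unfolding trajectory_pair_def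
    by (intro exI[of _ u] exI[of _ x]) (simp add: x_def D_def)
qed

section \<open>Interpolation of derivatives at the endpoints\<close>

text \<open>Each differentiation lowers the power of \<open>t - a\<close> by one and multiplies the
  value of the cofactor at \<open>a\<close> by the exponent (\<open>step\<close>). The cofactor
  changes, so it is kept arbitrary in both inductions.\<close>

lemma higher_pderiv_linear_power_mult:
  fixes q :: "real poly"
  shows "k < i \<Longrightarrow> poly ((pderiv ^^ k) ([:-a, 1:] ^ i * q)) a = 0"
    and "poly ((pderiv ^^ i) ([:-a, 1:] ^ i * q)) a = fact i * poly q a"
proof -
  have step: "pderiv ([:-a, 1:] ^ Suc j * r) = [:-a, 1:] ^ j * (of_nat (Suc j) * r + [:-a, 1:] * pderiv r)"
    for j and r :: "real poly"
    unfolding pderiv_mult pderiv_power_Suc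
    by (simp add: pderiv_pCons algebra_simps of_nat_poly)
  show "poly ((pderiv ^^ k) ([:-a, 1:] ^ i * q)) a = 0" if "k < i" for k
    using that
  proof (induction k arbitrary: i q)
    case 0
    then show ?case
      by (simp add: poly_power)
  next
    case (Suc k)
    then obtain j where "i = Suc j" "k < j"
      by (cases i) auto
    then show ?case
      using Suc.IH[OF \<open>k < j\<close>] by (simp only: funpow_Suc_right o_apply step)
  qed
  show "poly ((pderiv ^^ i) ([:-a, 1:] ^ i * q)) a = fact i * poly q a"
  proof (induction i arbitrary: q)
    case (Suc i)
    show ?case
      unfolding funpow_Suc_right o_apply step Suc.IH by (simp add: algebra_simps)
  qed simp
qed

text \<open>Hermite interpolation at \<open>0\<close> and \<open>1\<close>: of the derivatives of \<open>(t - a)^i (t - e)^n\<close> of order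
  below \<open>n\<close>, all vanish at \<open>e\<close>, and at \<open>a\<close> the \<open>i\<close>-th is the first that does not.\<close>

lemma endpoint_derivatives_subspace:
  fixes N :: "nat \<Rightarrow> 'a::real_vector" and R :: "('a \<times> 'a) set"
  assumes sub: "subspace R"
    and poly: "\<And>y. (\<Sum>k<n. poly ((pderiv ^^ k) y) 0 *\<^sub>R N k, \<Sum>k<n. poly ((pderiv ^^ k) y) 1 *\<^sub>R N k) \<in> R"
    and "i < n"
  shows "(N i, 0) \<in> R" "(0, N i) \<in> R"
proof -
  \<comment> \<open>Descending induction on \<open>i\<close>: derivatives of order below
    \<open>i\<close> vanish at \<open>a\<close>, the summands above \<open>i\<close> lie in
    \<open>S\<close> by induction, and the factor of \<open>N i\<close> is
    \<open>fact i * (a - e) ^ n\<close>, which is nonzero.\<close>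
  have main: "N i \<in> S"
    if "a \<noteq> e" "subspace S" "i < n"
      and S: "\<And>i. (\<Sum>k<n. poly ((pderiv ^^ k) ([:-a, 1:] ^ i * [:-e, 1:] ^ n)) a *\<^sub>R N k) \<in> S"
    for a e :: real and S i
    using \<open>i < n\<close>
  proof (induction "n - i" arbitrary: i rule: less_induct)
    case less
    let ?y = "[:-a, 1:] ^ i * [:-e, 1:] ^ n"
    have "(\<Sum>k<n. poly ((pderiv ^^ k) ?y) a *\<^sub>R N k) =
        (\<Sum>k\<in>{i..<n}. poly ((pderiv ^^ k) ?y) a *\<^sub>R N k)"
      using higher_pderiv_linear_power_mult(1)[of _ i a "[:-e, 1:] ^ n"]
      by (intro sum.mono_neutral_right) auto
    also have "\<dots> = poly ((pderiv ^^ i) ?y) a *\<^sub>R N i +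
        (\<Sum>k\<in>{Suc i..<n}. poly ((pderiv ^^ k) ?y) a *\<^sub>R N k)"
      using less.prems by (rule sum.atLeast_Suc_lessThan)
    finally have "poly ((pderiv ^^ i) ?y) a *\<^sub>R N i =
        (\<Sum>k<n. poly ((pderiv ^^ k) ?y) a *\<^sub>R N k) -
        (\<Sum>k\<in>{Suc i..<n}. poly ((pderiv ^^ k) ?y) a *\<^sub>R N k)"
      by simp
    also have "\<dots> \<in> S"
    proof (rule subspace_diff[OF \<open>subspace S\<close> S])
      show "(\<Sum>k\<in>{Suc i..<n}. poly ((pderiv ^^ k) ?y) a *\<^sub>R N k) \<in> S"
        using less.hyps by (intro subspace_sum subspace_scale \<open>subspace S\<close>) auto
    qed
    finally have "(1 / poly ((pderiv ^^ i) ?y) a) *\<^sub>R poly ((pderiv ^^ i) ?y) a *\<^sub>R N i \<in> S"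
      by (rule subspace_scale[OF \<open>subspace S\<close>])
    moreover have "poly ((pderiv ^^ i) ?y) a \<noteq> 0"
      using \<open>a \<noteq> e\<close> unfolding higher_pderiv_linear_power_mult(2) by (simp add: poly_power)
    ultimately show ?case
      by simp
  qed
  \<comment> \<open>The zero of order \<open>n\<close> at \<open>e\<close> makes the other end state
    \<open>0\<close>.\<close>
  have van: "(\<Sum>k<n. poly ((pderiv ^^ k) ([:-a, 1:] ^ i * [:-e, 1:] ^ n)) e *\<^sub>R N k) = 0"
    for a e :: real and i
    using higher_pderiv_linear_power_mult(1)[of _ n e "[:-a, 1:] ^ i"]
    by (intro sum.neutral) (auto simp: mult.commute)
  have s0: "subspace {z. (z, 0) \<in> R}" "subspace {z. (0, z) \<in> R}"
    using subspace_0[OF sub] subspace_add[OF sub, of "(_, 0)" "(_, 0)"]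
      subspace_scale[OF sub, of "(_, 0)"] subspace_add[OF sub, of "(0, _)" "(0, _)"]
      subspace_scale[OF sub, of "(0, _)"]
    unfolding subspace_def by (auto simp: zero_prod_def)
  have "N i \<in> {z. (z, 0) \<in> R}"
  proof (rule main[of 0 1, OF _ s0(1) \<open>i < n\<close>])
    show "(\<Sum>k<n. poly ((pderiv ^^ k) ([:-0, 1:] ^ i * [:-1, 1:] ^ n)) 0 *\<^sub>R N k) \<in> {z. (z, 0) \<in> R}" for i
      using poly[of "[:-0, 1:] ^ i * [:-1, 1:] ^ n"] unfolding van by simp
  qed simp
  then show "(N i, 0) \<in> R"
    by simp
  have "N i \<in> {z. (0, z) \<in> R}"
  proof (rule main[of 1 0, OF _ s0(2) \<open>i < n\<close>])
    show "(\<Sum>k<n. poly ((pderiv ^^ k) ([:-1, 1:] ^ i * [:-0, 1:] ^ n)) 1 *\<^sub>R N k) \<in> {z. (0, z) \<in> R}" for i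
      using poly[of "[:-1, 1:] ^ i * [:-0, 1:] ^ n"] unfolding van by simp
  qed simp
  then show "(0, N i) \<in> R"
    by simp
qed

section \<open>Krylov vectors and reachability\<close>

lemma span_image_lessThan:
  fixes f :: "nat \<Rightarrow> 'a::real_vector"
  assumes "x \<in> span (f ` {..<n})"
  obtains c where "x = (\<Sum>k<n. c k *\<^sub>R f k)"
proof -
  have "\<exists>c. x = (\<Sum>k<n. c k *\<^sub>R f k)"
    using assms
  proof (induction n arbitrary: x)
    case (Suc n)
    then obtain r where "x - r *\<^sub>R f n \<in> span (f ` {..<n})"
      by (auto simp: lessThan_Suc span_insert)
    then obtain c where "x - r *\<^sub>R f n = (\<Sum>k<n. c k *\<^sub>R f k)"
      using Suc.IH by blast
    then have "x = (\<Sum>k<Suc n. (c(n := r)) k *\<^sub>R f k)"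
      by (simp add: algebra_simps)
    then show ?case
      by blast
  qed simp
  then show thesis
    using that by blast
qed

text \<open>A monic annihilating polynomial of \<open>b\<close>: more Krylov vectors than the
  dimension cannot be independent, so one of them depends on its predecessors.\<close>

lemma krylov_relation:
  fixes A :: "real^'d^'d"
  obtains n p where "p n = 1" "(\<Sum>k\<le>n. p k *\<^sub>R krylov A b k) = 0"
proof -
  have "\<exists>n. krylov A b n \<in> span (krylov A b ` {..<n})"
  proof (rule ccontr)
    assume "\<not> ?thesis"
    then have notin: "krylov A b n \<notin> span (krylov A b ` {..<n})" for n
      by blast
    have "independent (krylov A b ` {..<n}) \<and> card (krylov A b ` {..<n}) = n" for n
    proof (induction n)
      case (Suc n)
      then show ?case
        using notin[of n] span_base[of "krylov A b n" "krylov A b ` {..<n}"]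
        by (auto simp: lessThan_Suc independent_insert)
    qed (simp add: independent_empty)
    from this[of "Suc (DIM(real^'d))"] show False
      using independent_bound[of "krylov A b ` {..<Suc (DIM(real^'d))}"] by auto
  qed
  then obtain n c where "krylov A b n = (\<Sum>k<n. c k *\<^sub>R krylov A b k)"
    by (metis span_image_lessThan)
  then have "(\<Sum>k\<le>n. ((\<lambda>k. - c k)(n := 1)) k *\<^sub>R krylov A b k) = 0"
    by (simp add: lessThan_Suc_atMost[symmetric] sum_negf)
  then show thesis
    by (rule that[rotated]) simp
qed

text \<open>As \<open>p\<close> is monic, the vectors \<open>flat_coeff\<close> are unitriangular
  combinations of the first \<open>n\<close> Krylov vectors, which therefore lie in
  \<open>S\<close>. The relation keeps all later ones in the span of these.\<close>

lemma krylov_in_subspace_flat_coeff: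
  assumes p: "p n = 1" "(\<Sum>k\<le>n. p k *\<^sub>R krylov A b k) = 0"
    and S: "subspace S" "\<And>i. i < n \<Longrightarrow> flat_coeff A b p n i \<in> S"
  shows "krylov A b k \<in> S"
proof -
  have low: "krylov A b k \<in> S" if "k < n" for k
    using that
  proof (induction k rule: less_induct)
    case (less k)
    \<comment> \<open>The index \<open>n - Suc k\<close> makes \<open>krylov A b k\<close> the last
      term, with coefficient \<open>p n = 1\<close>.\<close>
    have "flat_coeff A b p n (n - Suc k) =
        (\<Sum>j<k. p (n - Suc k + j + 1) *\<^sub>R krylov A b j) + krylov A b k"
      using less.prems p(1) by (simp add: flat_coeff_def Suc_diff_Suc)
    moreover have "(\<Sum>j<k. p (n - Suc k + j + 1) *\<^sub>R krylov A b j) \<in> S"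
      using less by (intro subspace_sum subspace_scale S(1)) auto
    moreover have "flat_coeff A b p n (n - Suc k) \<in> S"
      using less.prems by (intro S(2)) simp
    ultimately show ?case
      using subspace_diff[OF S(1)] by (metis add_diff_cancel_left')
  qed
  \<comment> \<open>\<open>S\<close> itself may fail to be invariant under \<open>A\<close>; the
    span \<open>W\<close> of the first \<open>n\<close> Krylov vectors is invariant.\<close>
  define W where "W = span (krylov A b ` {..<n})"
  have "W \<subseteq> S"
    unfolding W_def using low by (intro span_minimal S(1)) auto
  have "krylov A b n = - (\<Sum>k<n. p k *\<^sub>R krylov A b k)"
    using p by (simp add: lessThan_Suc_atMost[symmetric] eq_neg_iff_add_eq_0 add.commute)
  also have "\<dots> \<in> W"
    unfolding W_def by (intro span_neg span_sum span_scale span_base) auto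
  finally have "krylov A b (Suc k) \<in> W" if "k < n" for k
    using that unfolding W_def by (cases "Suc k = n") (auto intro: span_base)
  then have inv: "A *v z \<in> W" if "z \<in> W" for z
  proof -
    have "(\<lambda>z. A *v z) ` W = span ((\<lambda>z. A *v z) ` krylov A b ` {..<n})"
      unfolding W_def by (rule linear_span_image[symmetric]) simp
    also have "\<dots> \<subseteq> W"
      unfolding W_def[symmetric] using \<open>\<And>k. k < n \<Longrightarrow> krylov A b (Suc k) \<in> W\<close>
      by (intro span_minimal) (auto simp: krylov_Suc W_def)
    finally show ?thesis
      using that by blast
  qed
  show ?thesis
  proof (cases "n = 0")
    case True
    then have "b = 0"
      using p by simp
    then have "krylov A b k = 0"
      by (induction k) (simp_all add: krylov_Suc)
    then show ?thesis
      using subspace_0[OF S(1)] by simp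
  next
    case False
    then have "krylov A b 0 \<in> W"
      unfolding W_def by (intro span_base imageI) simp
    then have "krylov A b k \<in> W"
      by (induction k) (auto simp: krylov_Suc inv)
    then show ?thesis
      using \<open>W \<subseteq> S\<close> by blast
  qed
qed

text \<open>Every Krylov vector can be steered to \<open>0\<close> and reached from \<open>0\<close>
  in unit time. By linearity the same holds for every state, and
  \<open>(x0, x1) = (x0, 0) + (0, x1)\<close>.\<close>

lemma krylov_span_controllable:
  fixes A :: "real^'d^'d" and B :: "real^'m^'d"
  assumes "span {krylov A (column l B) k | l k. True} = UNIV"
  shows "controllable A B"
proof -
  define R where "R = {z. trajectory_pair A B (fst z) (snd z)}"
  have R: "subspace R"
    unfolding R_def by (rule subspace_trajectory_pair)
  have s0: "subspace {z. (z, 0) \<in> R}" "subspace {z. (0, z) \<in> R}"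
    using subspace_0[OF R] subspace_add[OF R, of "(_, 0)" "(_, 0)"]
      subspace_scale[OF R, of "(_, 0)"] subspace_add[OF R, of "(0, _)" "(0, _)"]
      subspace_scale[OF R, of "(0, _)"]
    unfolding subspace_def by (auto simp: zero_prod_def)
  have "(krylov A (column l B) k, 0) \<in> R \<and> (0, krylov A (column l B) k) \<in> R" for l k
  proof -
    obtain n p where p: "p n = 1" "(\<Sum>k\<le>n. p k *\<^sub>R krylov A (column l B) k) = 0"
      by (rule krylov_relation)
    have "(\<Sum>k<n. poly ((pderiv ^^ k) y) 0 *\<^sub>R flat_coeff A (column l B) p n k,
        \<Sum>k<n. poly ((pderiv ^^ k) y) 1 *\<^sub>R flat_coeff A (column l B) p n k) \<in> R" for y
      using flat_coeff_trajectory[OF p(2)] by (simp add: R_def)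
    note N = endpoint_derivatives_subspace[OF R this]
    show ?thesis
      using krylov_in_subspace_flat_coeff[OF p s0(1)] krylov_in_subspace_flat_coeff[OF p s0(2)] N
      by blast
  qed
  then have "span {krylov A (column l B) k | l k. True} \<subseteq> {z. (z, 0) \<in> R}"
    "span {krylov A (column l B) k | l k. True} \<subseteq> {z. (0, z) \<in> R}"
    by (intro span_minimal s0; blast)+
  then have "(x0, 0) \<in> R" "(0, x1) \<in> R" for x0 x1
    unfolding assms by blast+
  then have "(x0, x1) \<in> R" for x0 x1
    using subspace_add[OF R, of "(x0, 0)" "(0, x1)"] by simp
  then show ?thesis
    by (intro trajectory_pair_imp_controllable) (simp add: R_def)
qed

section \<open>Complex eigenvectors and the Hautus test\<close>

text \<open>Over the complex numbers the annihilating polynomial splits. Its factors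
  \<open>T - c\<close> are applied to \<open>z\<close> one after another; the last nonzero vector is
  an eigenvector, and all of them stay in \<open>V\<close>.\<close>

lemma eigenvector_in_invariant_set:
  fixes T :: "complex^'d \<Rightarrow> complex^'d"
  assumes T: "\<And>x y. T (x - y) = T x - T y" "\<And>c x. T (c *s x) = c *s T x"
    and V: "\<And>z c. z \<in> V \<Longrightarrow> T z - c *s z \<in> V"
    and "p \<noteq> 0" "degree p \<le> n" "z \<in> V" "z \<noteq> 0"
    and "(\<Sum>k\<le>n. coeff p k *s (T ^^ k) z) = 0"
  shows "\<exists>w c. w \<in> V \<and> w \<noteq> 0 \<and> T w = c *s w"
  using assms(4-)
proof (induction n arbitrary: p z)
  case 0
  then have "coeff p 0 \<noteq> 0"
    by (metis leading_coeff_0_iff le_zero_eq)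
  with 0 show ?case
    by (simp add: vector_mul_eq_0)
next
  case (Suc n)
  show ?case
  proof (cases "degree p = 0")
    \<comment> \<open>A nonzero constant cannot annihilate \<open>z \<noteq> 0\<close>.\<close>
    case True
    then have "coeff p 0 \<noteq> 0" "\<And>k. k > 0 \<Longrightarrow> coeff p k = 0"
      using Suc.prems(1) by (metis leading_coeff_0_iff) (simp add: True coeff_eq_0)
    moreover have "(\<Sum>k\<le>Suc n. coeff p k *s (T ^^ k) z) = coeff p 0 *s z"
      using calculation(2) by (subst sum.atMost_Suc_shift) simp
    ultimately show ?thesis
      using Suc.prems by (simp add: vector_mul_eq_0)
  next
    case False
    then obtain c where "poly p c = 0"
      by (metis constant_degree fundamental_theorem_of_algebra)
    then obtain q where p: "p = [:-c, 1:] * q"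
      by (metis dvdE poly_eq_0_iff_dvd)
    \<comment> \<open>If \<open>z'\<close> vanishes, \<open>z\<close> is an eigenvector; otherwise
      the cofactor \<open>q\<close>, of smaller degree, annihilates \<open>z'\<close>.\<close>
    define z' where "z' = T z - c *s z"
    show ?thesis
    proof (cases "z' = 0")
      case True
      then show ?thesis
        using Suc.prems z'_def by auto
    next
      case False
      have q: "q \<noteq> 0" "degree q \<le> n"
      proof -
        show "q \<noteq> 0"
          using Suc.prems(1) p by auto
        then have "degree p = degree [:-c, 1:] + degree q"
          unfolding p by (intro degree_mult_eq) auto
        then show "degree q \<le> n"
          using Suc.prems(2) by simp
      qed
      have Tz': "(T ^^ k) z' = (T ^^ Suc k) z - c *s (T ^^ k) z" for k
        by (induction k) (simp_all add: z'_def T)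
      have cp: "coeff p 0 = - c * coeff q 0" "coeff p (Suc k) = coeff q k - c * coeff q (Suc k)" for k
        by (simp_all add: p)
      have "(\<Sum>k\<le>Suc n. coeff p k *s (T ^^ k) z) =
          - (c * coeff q 0) *s z + (\<Sum>k\<le>n. (coeff q k - c * coeff q (Suc k)) *s (T ^^ Suc k) z)"
        by (subst sum.atMost_Suc_shift) (simp add: cp)
      also have "\<dots> = (\<Sum>k\<le>n. coeff q k *s (T ^^ Suc k) z) -
          (\<Sum>k\<le>Suc n. (c * coeff q k) *s (T ^^ k) z)"
        unfolding sum.atMost_Suc_shift[of "\<lambda>k. (c * coeff q k) *s (T ^^ k) z"]
        by (simp add: vec_eq_iff sum_subtractf algebra_simps)
      also have "(\<Sum>k\<le>Suc n. (c * coeff q k) *s (T ^^ k) z) = (\<Sum>k\<le>n. (c * coeff q k) *s (T ^^ k) z)"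
        using q(2) by (simp add: coeff_eq_0)
      also have "(\<Sum>k\<le>n. coeff q k *s (T ^^ Suc k) z) - (\<Sum>k\<le>n. (c * coeff q k) *s (T ^^ k) z) =
          (\<Sum>k\<le>n. coeff q k *s (T ^^ k) z')"
        by (simp add: Tz' vec_eq_iff sum_subtractf algebra_simps)
      finally have "(\<Sum>k\<le>n. coeff q k *s (T ^^ k) z') = 0"
        using Suc.prems by simp
      with q False show ?thesis
        using Suc.prems V by (intro Suc.IH[of q z']) (auto simp: z'_def)
    qed
  qed
qed

text \<open>If the Krylov vectors do not span, their complexified annihilator \<open>V\<close> is
  nonzero and invariant under the transpose of \<open>A\<close>, so it contains an eigenvector. This
  annihilates the columns of \<open>B\<close>, against \<open>hautus\<close>.\<close>

lemma popov_belevitch_hautus: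
  fixes A :: "real^'d^'d" and B :: "real^'m^'d"
  assumes hautus: "\<And>c v. (\<And>j. (\<Sum>i\<in>UNIV. v i * of_real (A $ i $ j)) = c * v j) \<Longrightarrow>
    (\<And>l. (\<Sum>i\<in>UNIV. v i * of_real (B $ i $ l)) = 0) \<Longrightarrow> \<forall>i. v i = (0 :: complex)"
  shows "controllable A B"
proof (rule krylov_span_controllable, rule ccontr)
  assume "span {krylov A (column l B) k | l k. True} \<noteq> UNIV"
  then obtain y where "y \<noteq> 0" and y: "span {krylov A (column l B) k | l k. True} \<subseteq> {z. y \<bullet> z = 0}"
    using span_not_univ_subset_hyperplane by blast
  have y0: "y \<bullet> krylov A (column l B) k = 0" for l k
    using y span_base[of "krylov A (column l B) k" "{krylov A (column l B) k | l k. True}"] by blast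
  define T :: "complex^'d \<Rightarrow> complex^'d" where
    "T z = (\<chi> j. \<Sum>i\<in>UNIV. z $ i * of_real (A $ i $ j))" for z
  define cv :: "real^'d \<Rightarrow> complex^'d" where "cv x = (\<chi> i. of_real (x $ i))" for x
  define V where "V = {z :: complex^'d. \<forall>l k. (\<Sum>i\<in>UNIV. z $ i * of_real (krylov A (column l B) k $ i)) = 0}"
  have T: "T (x - z) = T x - T z" "T (c *s x) = c *s T x" for x z c
    by (simp_all add: T_def vec_eq_iff sum_subtractf sum_distrib_left algebra_simps)
  \<comment> \<open>Adjointness turns an application of \<open>T\<close> into a shift of the Krylov
    index, which gives the invariance of \<open>V\<close>.\<close>
  have swap: "(\<Sum>i\<in>UNIV. T z $ i * of_real (x $ i)) = (\<Sum>i\<in>UNIV. z $ i * of_real ((A *v x) $ i))" for z x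
    unfolding T_def matrix_vector_mult_def
    by (simp add: sum_distrib_left sum_distrib_right mult.assoc) (rule sum.swap)
  have TV: "T z - c *s z \<in> V" if "z \<in> V" for z c
  proof -
    have "(\<Sum>i\<in>UNIV. T z $ i * of_real (krylov A (column l B) k $ i)) = 0" for l k
      using that unfolding swap krylov_Suc[symmetric] V_def by blast
    moreover have "(\<Sum>i\<in>UNIV. (c *s z) $ i * of_real (krylov A (column l B) k $ i)) = 0" for l k
      using that by (simp add: V_def mult.assoc flip: sum_distrib_left)
    ultimately show ?thesis
      by (simp add: V_def left_diff_distrib sum_subtractf)
  qed
  have cvT: "(T ^^ k) (cv y) = cv (krylov (transpose A) y k)" for k
    by (induction k) (simp_all add: krylov_Suc T_def cv_def vec_eq_iff matrix_vector_mult_def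
        transpose_def mult.commute)
  obtain n p where p: "p n = 1" "(\<Sum>k\<le>n. p k *\<^sub>R krylov (transpose A) y k) = 0"
    by (rule krylov_relation)
  define P where "P = (\<Sum>k\<le>n. monom (complex_of_real (p k)) k)"
  have cP: "coeff P k = (if k \<le> n then of_real (p k) else 0)" for k
    by (simp add: P_def coeff_sum coeff_monom)
  have "P \<noteq> 0"
    using cP[of n] p(1) by auto
  moreover have "degree P \<le> n"
    by (rule degree_le) (simp add: cP)
  moreover have "cv y \<in> V"
    using y0 by (simp add: V_def cv_def inner_vec_def flip: of_real_mult of_real_sum)
  moreover have "cv y \<noteq> 0"
    using \<open>y \<noteq> 0\<close> by (auto simp: cv_def vec_eq_iff)
  moreover have "(\<Sum>k\<le>n. coeff P k *s (T ^^ k) (cv y)) = 0"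
  proof -
    have "(\<Sum>k\<le>n. coeff P k *s (T ^^ k) (cv y)) = cv (\<Sum>k\<le>n. p k *\<^sub>R krylov (transpose A) y k)"
      unfolding cvT by (simp add: cv_def cP vec_eq_iff)
    then show ?thesis
      unfolding p(2) by (simp add: cv_def vec_eq_iff)
  qed
  ultimately obtain w c where w: "w \<in> V" "w \<noteq> 0" "T w = c *s w"
    using eigenvector_in_invariant_set[of T V P n "cv y"] T TV by blast
  have "\<forall>i. w $ i = 0"
  proof (rule hautus)
    show "(\<Sum>i\<in>UNIV. w $ i * of_real (A $ i $ j)) = c * w $ j" for j
      using w(3) by (simp add: T_def vec_eq_iff)
    show "(\<Sum>i\<in>UNIV. w $ i * of_real (B $ i $ l)) = 0" for l
      using w(1) unfolding V_def by (simp add: column_def) (metis (no_types, lifting) krylov_0 column_def vec_lambda_beta sum.cong)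
  qed
  then show False
    using w(2) by (simp add: vec_eq_iff)
qed

section \<open>Realizations built along a matching\<close>

text \<open>A path from \<open>S\<close> to its complement must leave \<open>S\<close>
  somewhere.\<close>

lemma strongly_connected_cut_edge:
  assumes "strongly_connected (state_digraph A)" "S \<noteq> {}" "S \<noteq> UNIV"
  obtains a b where "a \<in> S" "b \<notin> S" "A $ b $ a \<noteq> Zero"
proof -
  obtain x y where xy: "x \<in> S" "y \<notin> S"
    using assms(2,3) by blast
  have "(x, y) \<in> rtrancl_on UNIV (arcs_ends (state_digraph A))"
    using assms(1) by (auto simp: strongly_connected_def reachable_def state_digraph_def)
  then have "\<exists>a b. a \<in> S \<and> b \<notin> S \<and> (a, b) \<in> arcs_ends (state_digraph A)"
    using xy by (induction rule: rtrancl_on.induct) blast+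
  then show thesis
    using that by (auto simp: arcs_ends_conv state_digraph_def)
qed

text \<open>Here \<open>\<pi> i\<close> is the matching partner of the state \<open>i\<close>, and the inputs act through matched edges
  only. By the assumption \<open>resolvent\<close>, in the dual system the excitation of a single state at a
  frequency beyond radius \<open>K\<close> is seen at the inputs; this is what allows attaching a cycle with
  eigenvalues of modulus greater than \<open>K\<close> anywhere. By \<open>frontier\<close>, a state whose matched successor
  is still missing has no outgoing edges.\<close>

locale partial_realization =
  fixes A :: "entry^'d^'d" and \<pi> :: "'d \<Rightarrow> ('d, 'm) left_vertex" and S :: "'d set"
    and a :: "'d \<Rightarrow> 'd \<Rightarrow> real" and K :: real
  assumes bound_nonneg: "K \<ge> 0"
    and pattern: "a i j \<noteq> 0 \<Longrightarrow> A $ i $ j \<noteq> Zero"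
    and outside: "i \<notin> S \<or> j \<notin> S \<Longrightarrow> a i j = 0"
    and closed: "i \<in> S \<Longrightarrow> \<pi> i = V1 j \<Longrightarrow> j \<in> S"
    and frontier: "i \<notin> S \<Longrightarrow> \<pi> i = V1 j \<Longrightarrow> a k j = 0"
    and eigenvector: "\<And>c v i. (\<And>i. i \<notin> S \<Longrightarrow> v i = (0 :: complex)) \<Longrightarrow>
       (\<And>i. \<pi> i \<in> range U \<Longrightarrow> v i = 0) \<Longrightarrow>
       (\<And>j. (\<Sum>i\<in>UNIV. v i * of_real (a i j)) = c * v j) \<Longrightarrow> v i = 0"
    and resolvent: "\<And>c g s v. cmod c > K \<Longrightarrow> s \<in> S \<Longrightarrow>
       (\<And>i. i \<notin> S \<Longrightarrow> v i = (0 :: complex)) \<Longrightarrow> (\<And>i. \<pi> i \<in> range U \<Longrightarrow> v i = 0) \<Longrightarrow>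
       (\<And>j. c * v j = (\<Sum>i\<in>UNIV. v i * of_real (a i j)) + (if j = s then g else 0)) \<Longrightarrow> g = 0"

lemma partial_realization_empty: "partial_realization A \<pi> {} (\<lambda>i j. 0) 0"
  by (rule partial_realization.intro) auto

text \<open>The state \<open>b\<close> gets no entries in \<open>a\<close>, and its input forces
  \<open>v b = 0\<close>. If \<open>b\<close> is the excited state, its equation then reduces to
  \<open>g = 0\<close>.\<close>

lemma partial_realization_add_input:
  assumes pr: "partial_realization A \<pi> S a K" and "b \<notin> S" "\<pi> b = U u"
  shows "partial_realization A \<pi> (insert b S) a K"
proof (rule partial_realization.intro)
  fix c :: complex and v :: "'a \<Rightarrow> complex" and i
  assume v: "\<And>i. i \<notin> insert b S \<Longrightarrow> v i = 0" "\<And>i. \<pi> i \<in> range U \<Longrightarrow> v i = 0"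
    "\<And>j. (\<Sum>i\<in>UNIV. v i * of_real (a i j)) = c * v j"
  have vb: "v b = 0"
    using v(2)[of b] assms(3) by simp
  have "v i = 0" if "i \<notin> S" for i
    using that v(1)[of i] vb by (cases "i = b") auto
  then show "v i = 0"
    by (rule partial_realization.eigenvector[OF pr _ v(2,3)])
next
  fix c g :: complex and s and v :: "'a \<Rightarrow> complex"
  assume c: "cmod c > K" "s \<in> insert b S" and
    v: "\<And>i. i \<notin> insert b S \<Longrightarrow> v i = 0" "\<And>i. \<pi> i \<in> range U \<Longrightarrow> v i = 0"
    "\<And>j. c * v j = (\<Sum>i\<in>UNIV. v i * of_real (a i j)) + (if j = s then g else 0)"
  have vb: "v b = 0"
    using v(2)[of b] assms(3) by simp
  show "g = 0"
  proof (cases "s = b")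
    case True
    then show ?thesis
      using v(3)[of b] vb partial_realization.outside[OF pr, of _ b] \<open>b \<notin> S\<close> by simp
  next
    case False
    then have "s \<in> S"
      using c(2) by simp
    have "v i = 0" if "i \<notin> S" for i
      using that v(1)[of i] vb by (cases "i = b") auto
    then show ?thesis
      by (rule partial_realization.resolvent[OF pr c(1) \<open>s \<in> S\<close> _ v(2,3)])
  qed
next
  show "K \<ge> 0"
    by (rule partial_realization.bound_nonneg[OF pr])
  show "A $ i $ j \<noteq> Zero" if "a i j \<noteq> 0" for i j
    using that by (rule partial_realization.pattern[OF pr])
  show "a i j = 0" if "i \<notin> insert b S \<or> j \<notin> insert b S" for i j
    using that partial_realization.outside[OF pr, of i j] by blast
  show "j \<in> insert b S" if "i \<in> insert b S" "\<pi> i = V1 j" for i j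
    using that partial_realization.closed[OF pr, of i j] assms(3) by auto
  show "a k j = 0" if "i \<notin> insert b S" "\<pi> i = V1 j" for i j k
    using that partial_realization.frontier[OF pr, of i j k] by blast
qed

text \<open>By \<open>frontier\<close>, column \<open>t\<close> of \<open>a\<close> is empty, so the
  eigenvector equations at \<open>b\<close> and \<open>t\<close> read \<open>c * v b = 0\<close> and
  \<open>v b = c * v t\<close>, which forces \<open>v b = 0\<close>. An excitation at
  \<open>b\<close> reaches the old system as one of size \<open>v b\<close> at
  \<open>t\<close>.\<close>

lemma partial_realization_add_stem:
  fixes \<pi> :: "'d::finite \<Rightarrow> ('d, 'm) left_vertex" and A :: "entry^'d^'d"
  assumes pr: "partial_realization A \<pi> S a K" and \<pi>: "inj \<pi>"
    and edge: "A $ b $ t \<noteq> Zero" and b: "b \<notin> S" "\<pi> b = V1 t" "t \<in> S"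
  shows "partial_realization A \<pi> (insert b S) (\<lambda>i j. if i = b \<and> j = t then 1 else a i j) K"
    (is "partial_realization A \<pi> _ ?a K")
proof (rule partial_realization.intro)
  have ab: "a b j = 0" "a i b = 0" "a i t = 0" for i j
    using partial_realization.outside[OF pr, of b j] partial_realization.outside[OF pr, of i b]
      partial_realization.frontier[OF pr b(1,2), of i] b(1) by simp_all
  have "b \<noteq> t"
    using b by blast
  have sum: "(\<Sum>i\<in>UNIV. v i * of_real (?a i j)) =
      (\<Sum>i\<in>UNIV. v i * of_real (a i j)) + (if j = t then v b else 0)" for v :: "'d \<Rightarrow> complex" and j
  proof -
    have "(\<Sum>i\<in>UNIV. v i * of_real (?a i j)) =
        (\<Sum>i\<in>UNIV. v i * of_real (a i j) + (if i = b then if j = t then v b else 0 else 0))"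
      by (rule sum.cong) (auto simp: ab)
    then show ?thesis
      by (simp add: sum.distrib)
  qed
  {
    fix c :: complex and v :: "'d \<Rightarrow> complex" and i
    assume v: "\<And>i. i \<notin> insert b S \<Longrightarrow> v i = 0" "\<And>i. \<pi> i \<in> range U \<Longrightarrow> v i = 0"
      "\<And>j. (\<Sum>i\<in>UNIV. v i * of_real (?a i j)) = c * v j"
    have "c * v b = 0" "v b = c * v t"
      using v(3)[of b] v(3)[of t] \<open>b \<noteq> t\<close> unfolding sum by (simp_all add: ab)
    then have vb: "v b = 0"
      by auto
    have "v i = 0" if "i \<notin> S" for i
      using that v(1)[of i] vb by (cases "i = b") auto
    then show "v i = 0"
    proof (rule partial_realization.eigenvector[OF pr _ v(2)])
      show "(\<Sum>i\<in>UNIV. v i * of_real (a i j)) = c * v j" for j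
        using v(3)[of j] unfolding sum vb by simp
    qed
  next
    fix c g :: complex and s and v :: "'d \<Rightarrow> complex"
    assume c: "cmod c > K" "s \<in> insert b S" and
      v: "\<And>i. i \<notin> insert b S \<Longrightarrow> v i = 0" "\<And>i. \<pi> i \<in> range U \<Longrightarrow> v i = 0"
      "\<And>j. c * v j = (\<Sum>i\<in>UNIV. v i * of_real (?a i j)) + (if j = s then g else 0)"
    have "c \<noteq> 0"
      using c(1) partial_realization.bound_nonneg[OF pr] by auto
    have cvb: "c * v b = (if b = s then g else 0)"
      using v(3)[of b] \<open>b \<noteq> t\<close> unfolding sum by (simp add: ab)
    show "g = 0"
    proof (cases "s = b")
      case True
      define v' where "v' = v(b := 0)"
      have "(\<Sum>i\<in>UNIV. v i * of_real (a i j)) = (\<Sum>i\<in>UNIV. v' i * of_real (a i j))" for j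
        by (rule sum.cong) (auto simp: v'_def ab)
      then have "c * v' j = (\<Sum>i\<in>UNIV. v' i * of_real (a i j)) + (if j = t then v b else 0)" for j
        using v(3)[of j] True \<open>b \<noteq> t\<close> unfolding sum by (cases "j = b") (simp_all add: v'_def ab)
      moreover have "v' i = 0" if "i \<notin> S" for i
        using that v(1)[of i] by (simp add: v'_def)
      moreover have "v' i = 0" if "\<pi> i \<in> range U" for i
        using that v(2)[of i] by (simp add: v'_def)
      ultimately have "v b = 0"
        by (intro partial_realization.resolvent[OF pr c(1) b(3), of v' "v b"])
      then show ?thesis
        using cvb True by simp
    next
      case False
      then have vb: "v b = 0"
        using cvb \<open>c \<noteq> 0\<close> by auto
      have "s \<in> S"
        using c(2) False by simp
      show ?thesis
      proof (rule partial_realization.resolvent[OF pr c(1) \<open>s \<in> S\<close> _ v(2)])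
        show "v i = 0" if "i \<notin> S" for i
          using that v(1)[of i] vb by (cases "i = b") auto
        show "c * v j = (\<Sum>i\<in>UNIV. v i * of_real (a i j)) + (if j = s then g else 0)" for j
          using v(3)[of j] unfolding sum vb by simp
      qed
    qed
  }
  show "K \<ge> 0"
    by (rule partial_realization.bound_nonneg[OF pr])
  show "A $ i $ j \<noteq> Zero" if "?a i j \<noteq> 0" for i j
    using that edge partial_realization.pattern[OF pr, of i j] by (cases "i = b \<and> j = t") auto
  show "?a i j = 0" if "i \<notin> insert b S \<or> j \<notin> insert b S" for i j
    using that b(3) partial_realization.outside[OF pr, of i j] by auto
  show "j \<in> insert b S" if "i \<in> insert b S" "\<pi> i = V1 j" for i j
    using that b(2,3) partial_realization.closed[OF pr, of i j] by (cases "i = b") auto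
  show "?a k j = 0" if "i \<notin> insert b S" "\<pi> i = V1 j" for i j k
  proof -
    have "i \<notin> S" "i \<noteq> b"
      using that(1) by auto
    moreover have "j \<noteq> t"
      using injD[OF \<pi>, of i b] b(2) that(2) \<open>i \<noteq> b\<close> by auto
    ultimately show ?thesis
      using partial_realization.frontier[OF pr _ that(2)] by simp
  qed
qed

lemma funpow_cycle:
  assumes "inj q" "finite (range (\<lambda>k. (q ^^ k) b))"
  obtains n where "n > 0" "(q ^^ n) b = b"
proof (rule funpow_inj_finite[OF assms(1)])
  show "finite {y. \<exists>n. y = (q ^^ n) b}"
    using assms(2) by (simp add: full_SetCompr_eq)
qed (use that in blast)

text \<open>The partners of missing states are missing too, so the matching permutes these states.
  \<open>C\<close> is the cycle through \<open>b\<close>, with weight \<open>r\<close> on its edges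
  and one link from \<open>t\<close> to \<open>b\<close>. For an eigenvalue of modulus above
  \<open>K\<close> the old \<open>resolvent\<close> forces \<open>v b = 0\<close>, and this zero
  spreads round the cycle; a smaller one is no eigenvalue of the cycle.\<close>

lemma partial_realization_add_cycle:
  fixes \<pi> :: "'d::finite \<Rightarrow> ('d, 'm) left_vertex" and A :: "entry^'d^'d"
  assumes pr: "partial_realization A \<pi> S a K" and \<pi>: "inj \<pi>"
    and edge: "\<And>i j. \<pi> i = V1 j \<Longrightarrow> A $ i $ j \<noteq> Zero"
    and out: "\<And>i. i \<notin> S \<Longrightarrow> \<exists>j. j \<notin> S \<and> \<pi> i = V1 j"
    and bt: "b \<notin> S" "t \<in> S" "A $ b $ t \<noteq> Zero"
  shows "\<exists>C a' K'. b \<in> C \<and> C \<inter> S = {} \<and> partial_realization A \<pi> (S \<union> C) a' K'"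
proof -
  obtain q0 where q0: "\<And>i. i \<notin> S \<Longrightarrow> q0 i \<notin> S" "\<And>i. i \<notin> S \<Longrightarrow> \<pi> i = V1 (q0 i)"
    using out by metis
  \<comment> \<open>Extended by the identity on \<open>S\<close>, so that \<open>q\<close> is
    injective everywhere and its orbits are cycles.\<close>
  define q where "q i = (if i \<in> S then i else q0 i)" for i
  have qS: "q i \<notin> S" "\<pi> i = V1 (q i)" if "i \<notin> S" for i
    using q0[OF that] that by (simp_all add: q_def)
  have "inj q"
  proof (rule injI)
    fix x y assume eq: "q x = q y"
    show "x = y"
    proof (cases "x \<in> S \<or> y \<in> S")
      case True
      then show ?thesis
        using eq qS(1)[of x] qS(1)[of y] by (auto simp: q_def split: if_splits)
    next
      case False
      then show ?thesis
        using eq qS(2)[of x] qS(2)[of y] injD[OF \<pi>, of x y] by simp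
    qed
  qed
  define C where "C = range (\<lambda>k. (q ^^ k) b)"
  have bC: "b \<in> C"
    unfolding C_def by (rule range_eqI[of _ _ 0]) simp
  have "(q ^^ k) b \<notin> S" for k
    using bt(1) qS(1) by (induction k) auto
  then have CS: "x \<notin> S" if "x \<in> C" for x
    using that by (auto simp: C_def)
  have qC: "q x \<in> C" if x: "x \<in> C" for x
  proof -
    obtain k where "x = (q ^^ k) b"
      using x by (auto simp: C_def)
    then show ?thesis
      unfolding C_def by (intro range_eqI[of _ _ "Suc k"]) simp
  qed
  have injC: "inj_on q C"
    using \<open>inj q\<close> by (rule inj_on_subset) simp
  then have q_img: "q ` C = C"
    using qC by (intro endo_inj_surj) auto
  obtain N where N: "N > 0" "(q ^^ N) b = b"
    by (rule funpow_cycle[OF \<open>inj q\<close>]) simp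
  \<comment> \<open>Above \<open>K\<close>, so that \<open>resolvent\<close> for \<open>S\<close>
    applies at the eigenvalues of the cycle; \<open>r\<close> also becomes the new bound.\<close>
  define r where "r = K + 1"
  have "r > 0"
    using partial_realization.bound_nonneg[OF pr] by (simp add: r_def)
  define a' where "a' i j = a i j + (if i = b \<and> j = t then 1 else 0) + (if i \<in> C \<and> j = q i then r else 0)" for i j
  have sum: "(\<Sum>i\<in>UNIV. v i * of_real (a' i j)) = (\<Sum>i\<in>UNIV. v i * of_real (a i j)) +
      (if j = t then v b else 0) + (\<Sum>i\<in>C. if j = q i then r * v i else 0)" for v :: "'d \<Rightarrow> complex" and j
  proof -
    have "(\<Sum>i\<in>UNIV. v i * of_real (a' i j)) = (\<Sum>i\<in>UNIV. v i * of_real (a i j) +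
      (if i = b then if j = t then v b else 0 else 0) + (if i \<in> C then if j = q i then r * v i else 0 else 0))"
      by (rule sum.cong) (auto simp: a'_def algebra_simps)
    also have "\<dots> = (\<Sum>i\<in>UNIV. v i * of_real (a i j)) +
      (if j = t then v b else 0) + (\<Sum>i\<in>UNIV. if i \<in> C then if j = q i then r * v i else 0 else 0)"
      by (simp add: sum.distrib)
    also have "(\<Sum>i\<in>UNIV. if i \<in> C then if j = q i then r * v i else 0 else 0) =
        (\<Sum>i\<in>C. if j = q i then r * v i else 0)"
      by (simp add: sum.If_cases)
    finally show ?thesis .
  qed
  have sumC: "(\<Sum>i\<in>UNIV. v i * of_real (a' i (q x))) = r * v x" if "x \<in> C" for v :: "'d \<Rightarrow> complex" and x
  proof -
    have "a i (q x) = 0" for i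
      using CS[OF qC[OF that]] partial_realization.outside[OF pr, of i "q x"] by blast
    moreover have "q x \<noteq> t"
      using CS[OF qC[OF that]] bt(2) by blast
    moreover have "(\<Sum>i\<in>C. if q x = q i then r * v i else 0) = (\<Sum>i\<in>C. if x = i then r * v i else 0)"
      using \<open>inj q\<close> by (simp add: inj_eq)
    ultimately show ?thesis
      unfolding sum using that by simp
  qed
  have sumS: "(\<Sum>i\<in>UNIV. v i * of_real (a' i j)) = (\<Sum>i\<in>UNIV. v i * of_real (a i j)) +
      (if j = t then v b else 0)" if "j \<notin> C" for v :: "'d \<Rightarrow> complex" and j
  proof -
    have "(\<Sum>i\<in>C. if j = q i then r * v i else 0) = 0"
      using that qC by (intro sum.neutral) auto
    then show ?thesis
      unfolding sum by simp
  qed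
  \<comment> \<open>Restricted to \<open>S\<close>, the vector \<open>v\<close> solves the old
    equations with an excitation \<open>v b\<close> at \<open>t\<close>.\<close>
  have b_zero: "v b = 0"
    if "cmod c > K" "\<And>i. \<pi> i \<in> range U \<Longrightarrow> v i = 0" "\<And>j. j \<in> S \<Longrightarrow> (\<Sum>i\<in>UNIV. v i * of_real (a' i j)) = c * v j"
    for c and v :: "'d \<Rightarrow> complex"
  proof (rule partial_realization.resolvent[OF pr that(1) bt(2)])
    define vS where "vS i = (if i \<in> S then v i else 0)" for i
    show "vS i = 0" if "i \<notin> S" for i
      using that by (simp add: vS_def)
    show "vS i = 0" if "\<pi> i \<in> range U" for i
      using that \<open>\<And>i. \<pi> i \<in> range U \<Longrightarrow> v i = 0\<close> by (simp add: vS_def)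
    show "c * vS j = (\<Sum>i\<in>UNIV. vS i * of_real (a i j)) + (if j = t then v b else 0)" for j
    proof (cases "j \<in> S")
      case True
      have "(\<Sum>i\<in>UNIV. vS i * of_real (a i j)) = (\<Sum>i\<in>UNIV. v i * of_real (a i j))"
        using partial_realization.outside[OF pr] by (intro sum.cong) (auto simp: vS_def)
      moreover have "j \<notin> C"
        using CS True by blast
      ultimately show ?thesis
        using that(3)[OF True] True unfolding sumS[OF \<open>j \<notin> C\<close>] by (simp add: vS_def)
    next
      case False
      then have "a i j = 0" for i
        using partial_realization.outside[OF pr] by blast
      then show ?thesis
        using False bt(2) by (auto simp: vS_def)
    qed
  qed
  text \<open>The eigenvalues of the cycle have modulus \<open>r\<close>.\<close>
  have C_zero: "v x = 0" if "cmod c \<noteq> r" "\<And>x. x \<in> C \<Longrightarrow> c * v (q x) = r * v x" "x \<in> C"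
    for c x and v :: "'d \<Rightarrow> complex"
  proof -
    \<comment> \<open>As \<open>q\<close> permutes \<open>C\<close>, both sides carry the same sum
      of moduli, so this sum vanishes unless \<open>cmod c = r\<close>.\<close>
    have "(\<Sum>x\<in>C. cmod c * cmod (v (q x))) = (\<Sum>x\<in>C. r * cmod (v x))"
      using that(2) \<open>r > 0\<close> by (intro sum.cong refl) (metis abs_of_pos norm_mult norm_of_real)
    moreover have "(\<Sum>x\<in>C. cmod (v (q x))) = (\<Sum>x\<in>C. cmod (v x))"
      using sum.reindex[OF injC, of "\<lambda>x. cmod (v x)"] by (simp add: q_img)
    ultimately have "(\<Sum>x\<in>C. cmod (v x)) = 0"
      using that(1) by (simp flip: sum_distrib_left)
    then show ?thesis
      using that(3) by (subst (asm) sum_nonneg_eq_0_iff) auto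
  qed
  have "partial_realization A \<pi> (S \<union> C) a' r"
  proof (rule partial_realization.intro)
    show "r \<ge> 0"
      using \<open>r > 0\<close> by simp
    show "A $ i $ j \<noteq> Zero" if "a' i j \<noteq> 0" for i j
      using that partial_realization.pattern[OF pr, of i j] bt(3) edge[OF qS(2)[OF CS]]
      by (auto simp: a'_def split: if_splits)
    show "a' i j = 0" if "i \<notin> S \<union> C \<or> j \<notin> S \<union> C" for i j
      using that partial_realization.outside[OF pr, of i j] bt(2) bC qC by (auto simp: a'_def)
    show "j \<in> S \<union> C" if "i \<in> S \<union> C" "\<pi> i = V1 j" for i j
      using that partial_realization.closed[OF pr, of i j] qS(2)[OF CS, of i] qC[of i] by auto
    show "a' k j = 0" if "i \<notin> S \<union> C" "\<pi> i = V1 j" for i j k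
    proof -
      have j: "j = q i" "j \<notin> S"
        using that qS[of i] by auto
      then have "j \<noteq> q k" if "k \<in> C"
        using \<open>i \<notin> S \<union> C\<close> that injD[OF \<open>inj q\<close>, of i k] by auto
      then show ?thesis
        using j(2) bt(2) partial_realization.outside[OF pr, of k j] by (auto simp: a'_def)
    qed
  next
    fix c :: complex and v :: "'d \<Rightarrow> complex" and i
    assume v: "\<And>i. i \<notin> S \<union> C \<Longrightarrow> v i = 0" "\<And>i. \<pi> i \<in> range U \<Longrightarrow> v i = 0"
      "\<And>j. (\<Sum>i\<in>UNIV. v i * of_real (a' i j)) = c * v j"
    have cyc: "c * v (q x) = r * v x" if "x \<in> C" for x
      using v(3)[of "q x"] unfolding sumC[OF that] by simp
    have vC: "v x = 0" if "x \<in> C" for x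
    proof (cases "cmod c > K")
      case True
      then have "c \<noteq> 0"
        using partial_realization.bound_nonneg[OF pr] by auto
      have "v ((q ^^ k) b) = 0" for k
      proof (induction k)
        case 0
        then show ?case
          using b_zero[OF True v(2,3)] by simp
      next
        case (Suc k)
        then show ?case
          using cyc[of "(q ^^ k) b"] \<open>c \<noteq> 0\<close> by (simp add: C_def)
      qed
      then show ?thesis
        using that by (auto simp: C_def)
    next
      case False
      then show ?thesis
        using C_zero[of c v x] cyc that by (simp add: r_def)
    qed
    show "v i = 0"
    proof (rule partial_realization.eigenvector[OF pr _ v(2)])
      show "v i = 0" if "i \<notin> S" for i
        using v(1)[of i] vC[of i] that by blast
      show "(\<Sum>i\<in>UNIV. v i * of_real (a i j)) = c * v j" for j
      proof (cases "j \<in> C")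
        case True
        then have "a i j = 0" for i
          using partial_realization.outside[OF pr] CS by blast
        then show ?thesis
          using vC[OF True] by simp
      next
        case False
        then show ?thesis
          using v(3)[of j] vC[OF bC] unfolding sumS[OF False] by (simp split: if_splits)
      qed
    qed
  next
    fix c g :: complex and s and v :: "'d \<Rightarrow> complex"
    assume c: "cmod c > r" "s \<in> S \<union> C" and
      v: "\<And>i. i \<notin> S \<union> C \<Longrightarrow> v i = 0" "\<And>i. \<pi> i \<in> range U \<Longrightarrow> v i = 0"
      "\<And>j. c * v j = (\<Sum>i\<in>UNIV. v i * of_real (a' i j)) + (if j = s then g else 0)"
    have "c \<noteq> 0" "cmod c > K"
      using c(1) partial_realization.bound_nonneg[OF pr] by (auto simp: r_def)
    have cyc: "c * v (q x) = r * v x + (if q x = s then g else 0)" if "x \<in> C" for x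
      using v(3)[of "q x"] unfolding sumC[OF that] .
    show "g = 0"
    proof (cases "s \<in> S")
      case True
      then have "q x \<noteq> s" if "x \<in> C" for x
        using CS qC that by blast
      then have vC: "v x = 0" if "x \<in> C" for x
        using C_zero[of c v x] cyc c(1) that by simp
      show ?thesis
      proof (rule partial_realization.resolvent[OF pr \<open>cmod c > K\<close> True _ v(2)])
        show "v i = 0" if "i \<notin> S" for i
          using v(1)[of i] vC[of i] that by blast
        show "c * v j = (\<Sum>i\<in>UNIV. v i * of_real (a i j)) + (if j = s then g else 0)" for j
        proof (cases "j \<in> C")
          case True
          then have "a i j = 0" for i
            using partial_realization.outside[OF pr] CS by blast
          then show ?thesis
            using vC[OF True] True CS \<open>s \<in> S\<close> by auto
        next
          case False
          then show ?thesis
            using v(3)[of j] unfolding sumS[OF False] vC[OF bC] by simp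
        qed
      qed
    next
      case False
      then have "s \<in> C"
        using c(2) by blast
      have vb: "v b = 0"
        using v(3) False by (intro b_zero[OF \<open>cmod c > K\<close> v(2)]) auto
      \<comment> \<open>With the least period, the walk from \<open>s\<close> round the cycle meets
        the excitation only on its last edge; before that, zeros of \<open>v\<close> propagate in
        both directions.\<close>
      define n where "n = (LEAST n. n > 0 \<and> (q ^^ n) s = s)"
      obtain n0 where "n0 > 0" "(q ^^ n0) s = s"
        by (rule funpow_cycle[OF \<open>inj q\<close>]) simp
      then have n: "n > 0" "(q ^^ n) s = s"
        unfolding n_def by (metis (mono_tags, lifting) LeastI)+
      have n_least: "(q ^^ j) s \<noteq> s" if "0 < j" "j < n" for j
        using not_less_Least[OF that(2)[unfolded n_def]] that(1) by blast
      have sC: "(q ^^ j) s \<in> C" for j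
        using \<open>s \<in> C\<close> qC by (induction j) auto
      have iff: "v ((q ^^ j) s) = 0 \<longleftrightarrow> v s = 0" if "j < n" for j
        using that
      proof (induction j)
        case (Suc j)
        then show ?case
          using cyc[OF sC[of j]] n_least[of "Suc j"] \<open>c \<noteq> 0\<close> \<open>r > 0\<close> by auto
      qed simp
      obtain k where "s = (q ^^ k) b"
        using \<open>s \<in> C\<close> by (auto simp: C_def)
      \<comment> \<open>As \<open>N > 0\<close>, the difference is not truncated, and this many
        steps lead from \<open>s\<close> on to \<open>b\<close>. Reducing modulo \<open>n\<close>
        brings the exponent into the range of \<open>iff\<close>.\<close>
      then have "(q ^^ (N * k - k)) s = (q ^^ (N * k - k + k)) b"
        by (simp add: funpow_add)
      also have "N * k - k + k = N * k"
        using N(1) by simp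
      also have "(q ^^ (N * k)) b = b"
        using funpow_mod_eq[OF N(2), of "N * k"] by simp
      finally have "(q ^^ ((N * k - k) mod n)) s = b"
        using funpow_mod_eq[OF n(2), of "N * k - k"] by simp
      then have "v s = 0"
        using iff[of "(N * k - k) mod n"] n(1) vb by simp
      then have "v ((q ^^ (n - 1)) s) = 0"
        using iff[of "n - 1"] n(1) by simp
      moreover have "q ((q ^^ (n - 1)) s) = s"
        using n by (cases n) simp_all
      ultimately show ?thesis
        using cyc[OF sC[of "n - 1"]] \<open>v s = 0\<close> by simp
    qed
  qed
  then show ?thesis
    using bC CS by blast
qed

text \<open>A proper \<open>S\<close> always grows: by a state matched to an input, by one whose
  partner lies in \<open>S\<close>, or, when the missing states form cycles, by a cycle entered
  through an edge that leaves \<open>S\<close>.\<close>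

lemma partial_realization_UNIV:
  fixes \<pi> :: "'d::finite \<Rightarrow> ('d, 'm) left_vertex" and A :: "entry^'d^'d"
  assumes sc: "strongly_connected (state_digraph A)" and \<pi>: "inj \<pi>"
    and edge: "\<And>i j. \<pi> i = V1 j \<Longrightarrow> A $ i $ j \<noteq> Zero" and input: "\<pi> i0 = U u0"
  shows "\<exists>a K. partial_realization A \<pi> UNIV a K"
proof -
  have ext: "\<exists>S' a' K'. S \<subset> S' \<and> partial_realization A \<pi> S' a' K'"
    if pr: "partial_realization A \<pi> S a K" and "S \<noteq> UNIV" for S a K
  proof (cases "\<exists>i u. i \<notin> S \<and> \<pi> i = U u")
    case True
    then obtain i u where iu: "i \<notin> S" "\<pi> i = U u"
      by auto
    then have sub: "S \<subset> insert i S"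
      by auto
    show ?thesis
      by (intro exI conjI) (rule sub, rule partial_realization_add_input[OF pr iu])
  next
    case noU: False
    show ?thesis
    proof (cases "\<exists>i j. i \<notin> S \<and> \<pi> i = V1 j \<and> j \<in> S")
      case True
      then obtain i j where ij: "i \<notin> S" "\<pi> i = V1 j" "j \<in> S"
        by auto
      then have sub: "S \<subset> insert i S"
        by auto
      show ?thesis
        by (intro exI conjI) (rule sub, rule partial_realization_add_stem[OF pr \<pi> edge[OF ij(2)] ij])
    next
      case False
      then have out: "\<exists>j. j \<notin> S \<and> \<pi> i = V1 j" if "i \<notin> S" for i
        using noU that by (cases "\<pi> i") blast+
      \<comment> \<open>No state matched to an input is missing, so \<open>i0\<close> lies in
        \<open>S\<close>.\<close>
      have "S \<noteq> {}"
        using noU input by blast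
      then obtain t b where bt: "t \<in> S" "b \<notin> S" "A $ b $ t \<noteq> Zero"
        using strongly_connected_cut_edge[OF sc _ \<open>S \<noteq> UNIV\<close>] by metis
      from partial_realization_add_cycle[OF pr \<pi> edge out bt(2,1,3)] obtain C a' K'
        where C: "b \<in> C" "partial_realization A \<pi> (S \<union> C) a' K'"
        by metis
      then have sub: "S \<subset> S \<union> C"
        using bt(2) by auto
      show ?thesis
        by (intro exI conjI) (rule sub, rule C(2))
    qed
  qed
  have "\<exists>a K. partial_realization A \<pi> UNIV a K" if "partial_realization A \<pi> S a K" for S a K
    using that
  proof (induction "card (- S)" arbitrary: S a K rule: less_induct)
    case less
    show ?case
    proof (cases "S = UNIV")
      case False
      then obtain S' a' K' where S': "S \<subset> S'" "partial_realization A \<pi> S' a' K'"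
        using ext[OF less.prems] by blast
      then have "card (- S') < card (- S)"
        by (intro psubset_card_mono) auto
      then show ?thesis
        using less.hyps S'(2) by blast
    qed (use less.prems in blast)
  qed
  then show ?thesis
    using partial_realization_empty by blast
qed

text \<open>Matched input edges get the value 1. As \<open>\<pi>\<close> is injective, each column
  of \<open>B'\<close> has at most one nonzero entry, so a left eigenvector killed by
  \<open>B'\<close> vanishes at all states matched to inputs, as \<open>eigenvector\<close>
  requires.\<close>

lemma structurally_controllable_matrix_of_matching:
  fixes A :: "entry^'d^'d" and B :: "entry^'m^'d"
  assumes sc: "strongly_connected (state_digraph A)"
    and M: "matching (Gamma_AB A B) M" "snd ` M = UNIV" and "\<not> M \<subseteq> edges_A A"
  shows "structurally_controllable A (matrix_of_matching B M)"
proof -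
  have "\<exists>l. (l, i) \<in> M" for i
    using M(2) by (metis UNIV_I imageE prod.collapse)
  then obtain \<pi> where \<pi>: "\<And>i. (\<pi> i, i) \<in> M"
    by metis
  have "inj \<pi>"
  proof (rule injI)
    fix i k assume "\<pi> i = \<pi> k"
    then have "(\<pi> i, i) = (\<pi> k, k)"
      using M(1) \<pi>[of i] \<pi>[of k] unfolding matching_def by (metis fst_conv inj_onD)
    then show "i = k"
      by simp
  qed
  have M_edges: "M \<subseteq> edges_A A \<union> edges_B B"
    using M(1) by (simp add: matching_def edges_Gamma_AB)
  have edge: "A $ i $ j \<noteq> Zero" if "\<pi> i = V1 j" for i j
    using \<pi>[of i] M_edges that by (auto simp: edges_A_def edges_B_def)
  obtain e where "e \<in> M" "e \<in> edges_B B"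
    using assms(4) M_edges by blast
  then obtain u0 i0 where "(U u0, i0) \<in> M"
    by (auto simp: edges_B_def)
  then have "\<pi> i0 = U u0"
    using M(1) \<pi>[of i0] unfolding matching_def by (metis inj_onD prod.inject snd_conv)
  then obtain a K where pr: "partial_realization A \<pi> UNIV a K"
    using partial_realization_UNIV[OF sc \<open>inj \<pi>\<close> edge] by metis
  define A' :: "real^'d^'d" where "A' = (\<chi> i j. a i j)"
  define B' :: "real^'m^'d" where "B' = (\<chi> i u. if \<pi> i = U u then 1 else 0)"
  have "realization A A'"
    using partial_realization.pattern[OF pr] by (auto simp: realization_def A'_def)
  moreover have "realization (matrix_of_matching B M) B'"
  proof -
    have "(U u, i) \<in> M \<inter> edges_B B" if "\<pi> i = U u" for i u
      using \<pi>[of i] that M_edges by (auto simp: edges_A_def)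
    then show ?thesis
      by (auto simp: realization_def B'_def matrix_of_matching_def)
  qed
  moreover have "controllable A' B'"
  proof (rule popov_belevitch_hautus)
    fix c and v :: "'d \<Rightarrow> complex"
    assume v: "\<And>j. (\<Sum>i\<in>UNIV. v i * of_real (A' $ i $ j)) = c * v j"
      "\<And>u. (\<Sum>i\<in>UNIV. v i * of_real (B' $ i $ u)) = 0"
    have v0: "v i = 0" if "\<pi> i \<in> range U" for i
    proof -
      obtain u where u: "\<pi> i = U u"
        using \<open>\<pi> i \<in> range U\<close> by auto
      have "\<pi> k = U u \<longleftrightarrow> k = i" for k
        using inj_eq[OF \<open>inj \<pi>\<close>, of k i] unfolding u .
      then have "v k * of_real (B' $ k $ u) = (if k = i then v k else 0)" for k
        by (simp add: B'_def)
      then show ?thesis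
        using v(2)[of u] by simp
    qed
    have eq: "(\<Sum>i\<in>UNIV. v i * of_real (a i j)) = c * v j" for j
      using v(1)[of j] by (simp add: A'_def)
    have "v i = 0" for i
      by (rule partial_realization.eigenvector[OF pr _ v0 eq]) simp
    then show "\<forall>i. v i = 0"
      by blast
  qed
  ultimately show ?thesis
    unfolding structurally_controllable_def by blast
qed

section \<open>Optimality of the output of the algorithm\<close>

theorem lemma4p8:
  fixes A :: "entry^'d^'d" and B :: "entry^'m^'d" and w :: "real^'m^'d" and Bs :: "entry^'m^'d"
  assumes "structurally_controllable A B"
    and "strongly_connected (state_digraph A)"
    and "\<not> (\<exists>M. perfect_matching (Gamma_A A B) M)"
    and "\<And>i j. B $ i $ j \<noteq> Zero \<Longrightarrow> w $ i $ j > 0"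
    and "matching_algorithm_output A B w Bs"
  shows "Bs \<in> feasible A B \<and>
    (\<forall>B''\<in>feasible A B. norm0 Bs \<le> norm0 B'') \<and>
    (\<forall>B'\<in>feasible A B. (\<forall>B''\<in>feasible A B. norm0 B' \<le> norm0 B'') \<longrightarrow> norm_w w Bs \<le> norm_w w B')"
proof -
  obtain M where M: "min_cost_maximum_matching (Gamma_AB A B) (edge_cost w) M"
    and Bs: "Bs = matrix_of_matching B M"
    using assms(5) unfolding matching_algorithm_output_def by blast
  have maxM: "maximum_matching (Gamma_AB A B) M"
    and minM: "\<And>N. maximum_matching (Gamma_AB A B) N \<Longrightarrow> sum (edge_cost w) M \<le> sum (edge_cost w) N"
    using M by (simp_all add: min_cost_maximum_matching_def)
  obtain M0 where M0: "matching (Gamma_AB A B) M0" "snd ` M0 = UNIV"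
    using structurally_controllable_imp_saturating[OF assms(1)] .
  note max_iff = maximum_matching_iff_saturating[OF M0]
  have mM: "matching (Gamma_AB A B) M" and satM: "snd ` M = UNIV"
    using maxM by (simp_all add: max_iff)
  have part: "card N = card (N \<inter> edges_A A) + card (N \<inter> edges_B B)"
    if "matching (Gamma_AB A B) N" for N
  proof -
    have "N \<subseteq> edges_A A \<union> edges_B B" "finite N"
      using that finite_subset[OF _ finite_edges] by (auto simp: matching_def edges_Gamma_AB)
    then show ?thesis
      using edges_AB_disjoint[of A B]
      by (subst card_Un_disjoint[symmetric]) (auto intro!: arg_cong[where f = card])
  qed
  \<comment> \<open>Otherwise \<open>M\<close> would match all rows to equally many distinct state
    columns and be perfect in \<open>Gamma_A A B\<close>.\<close>
  have "\<not> M \<subseteq> edges_A A"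
  proof
    assume sub: "M \<subseteq> edges_A A"
    have "fst ` M \<subseteq> range V1"
      using sub by (auto simp: edges_A_def)
    moreover have "card (fst ` M) = card (range (V1 :: 'd \<Rightarrow> ('d, 'm) left_vertex))"
    proof -
      have "card (fst ` M) = card (snd ` M)"
        using mM by (simp add: matching_def card_image)
      then show ?thesis
        by (simp add: satM card_image inj_def)
    qed
    ultimately have "fst ` M = range V1"
      by (simp add: card_subset_eq)
    then have "perfect_matching (Gamma_A A B) M"
      using sub mM satM by (simp add: Gamma_A_eq perfect_matching_def matching_def)
    with assms(3) show False
      by blast
  qed
  then have "structurally_controllable A Bs"
    unfolding Bs by (rule structurally_controllable_matrix_of_matching[OF assms(2) mM satM])
  moreover have "zeros B \<subseteq> zeros Bs"
    by (auto simp: Bs zeros_def matrix_of_matching_def edges_B_def)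
  ultimately have feas: "Bs \<in> feasible A B"
    by (simp add: feasible_def)
  \<comment> \<open>Both bounds are proved against every feasible \<open>B'\<close>; the constrained
    minimum is a special case.\<close>
  have "norm0 Bs \<le> norm0 B' \<and> norm_w w Bs \<le> norm_w w B'" if "B' \<in> feasible A B" for B'
  proof -
    have zeros: "zeros B \<subseteq> zeros B'" and "structurally_controllable A B'"
      using that by (simp_all add: feasible_def)
    then obtain N where N': "matching (Gamma_AB A B') N" and satN: "snd ` N = UNIV"
      using structurally_controllable_imp_saturating by metis
    have N: "matching (Gamma_AB A B) N"
      by (rule matching_Gamma_AB_mono[OF N' zeros])
    have NB: "N \<inter> edges_B B \<subseteq> edges_B B'"
      using N' edges_AB_disjoint[of A B] by (auto simp: matching_def edges_Gamma_AB)
    have fin: "finite (edges_B B')"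
      using finite_edges[of A B'] by (simp add: edges_Gamma_AB)
    have "card M = card N"
      using card_matching(2)[OF mM] card_matching(2)[OF N] satM satN by simp
    moreover have "card (N \<inter> edges_A A) \<le> card (M \<inter> edges_A A)"
      using min_cost_maximum_matching_card_A[OF assms(4) M satM N] .
    \<comment> \<open>Both matchings have one edge per row, so the one with at least as many edges
      of \<open>A\<close> has at most as many input edges.\<close>
    ultimately have "card (M \<inter> edges_B B) \<le> card (N \<inter> edges_B B)"
      using part[OF mM] part[OF N] by linarith
    also have "\<dots> \<le> card (edges_B B')"
      using NB by (rule card_mono[OF fin])
    finally have "norm0 Bs \<le> norm0 B'"
      by (simp add: Bs edges_B_matrix_of_matching flip: card_edges_B)
    moreover have "norm_w w Bs \<le> norm_w w B'"
    proof -
      have "norm_w w Bs = sum (edge_cost w) M"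
        by (simp add: Bs edges_B_matrix_of_matching sum_edge_cost_matching[OF mM] flip: sum_edges_B)
      also have "\<dots> \<le> sum (edge_cost w) N"
        using N satN by (intro minM) (simp add: max_iff)
      also have "\<dots> = sum (edge_cost w) (N \<inter> edges_B B)"
        by (rule sum_edge_cost_matching[OF N])
      also have "\<dots> \<le> sum (edge_cost w) (edges_B B')"
      \<comment> \<open>\<open>B'\<close> may have entries outside \<open>N\<close>; with positive
        costs these only add to the sum.\<close>
      proof (rule sum_mono2[OF fin NB])
        fix e assume "e \<in> edges_B B' - N \<inter> edges_B B"
        then have "e \<in> edges_B B"
          using edges_B_mono[OF zeros] by blast
        then show "0 \<le> edge_cost w e"
          using assms(4) by (auto simp: edges_B_def less_imp_le)
      qed
      also have "\<dots> = norm_w w B'"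
        by (rule sum_edges_B)
      finally show ?thesis .
    qed
    ultimately show ?thesis ..
  qed
  with feas show ?thesis
    by blast
qed

end
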